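(* There exists a constant $\kappa$ depending only on $C_L$ and $C_{\mathcal A}$ such that the following holds. Suppose that Assumptions 1, 2-(i) and 3 of the context hold, and let $\alpha\in(0,1]$ with $\mathcal A_{d_\alpha}$ the finite subset of $\mathcal A$ from Assumption 3. If the separation quantity satisfies $D\ge\sqrt{\kappa/d^\alpha}$, then for any $(\mathbf X,k)$ generated from the data distribution of the deformation model there exists a network $\mathbf p=(p_1,p_2)\in\mathcal G(\alpha,|\mathcal A_{d_\alpha}|)$ such that the corresponding classifier $\widetilde k(\mathbf X)=\mathbf 1(p_2(\overline{\mathbf X})>1/2)$ satisfies $$\widetilde k(\mathbf X)=k,\quad\text{almost surely.}$$
   Context: Notation: $\|\cdot\|_p$ is the $L^p$-norm on $[0,1]^2$; for $A=(a_1,a_2)$, $\|A\|_\infty=\max_i\sup_{z\in[0,1]^2}|a_i(z)|$; the support of $g$ is $\{x:g(x)\ne0\}$; $x\vee y=\max$, $x\wedge y=\min$; $I_{j,\ell}=[\frac{j-1}d,\frac jd)\times[\frac{\ell-1}d,\frac\ell d)$. Deformation model and data distribution: $f_0,f_1:\mathbb R^2\to[0,\infty)$ are template functions, not identically zero; $\mathcal A$ is a class of maps $A=(a_1,a_2):\mathbb R^2\to\mathbb R^2$. The random pair $(\mathbf X,k)$ is generated by drawing $k\in\{0,1\}$ Bernoulli with success probability $\pi\in[0,1]$, $A$ from a distribution $Q_{\mathcal A}$ on $\mathcal A$, $\eta$ from a distribution $Q_\eta$ on $(0,\infty)$, with $\eta$ and $A$ independent, and setting $\mathbf X=(X_{j,\ell})_{j,\ell=1,\dots,d}$,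 $X_{j,\ell}=d^2\eta\int_{I_{j,\ell}}f_k(A(u,v))\,du\,dv$. The normalized image is $\overline{\mathbf X}$ with entries $\overline X_{j,\ell}=X_{j,\ell}/\sqrt{\sum_{j,\ell=1}^dX_{j,\ell}^2}$. Assumption 1: the supports of $f_0,f_1$ are contained in a rectangle $R=[\beta_{\mathrm{left}},\beta_{\mathrm{right}}]\times[\beta_{\mathrm{down}},\beta_{\mathrm{up}}]\subseteq[0,1]^2$, and for a constant $C_L>0$, $|f_k(u,v)-f_k(u',v')|\le C_L\|f_k\|_1(|u-u'|+|v-v'|)$ for all reals $u,v,u',v'$, $k=0,1$. Assumption 2-(i): $\mathcal A$ contains the identity; every $A=(a_1,a_2)\in\mathcal A$ satisfies $R\subseteq A([0,1]^2)$, and $a_1,a_2$ have continuous partial derivatives on $\mathbb R^2$ bounded in supremum norm by $C_{\mathcal A}$. The inclusion encodes full visibility of the deformed object: it is understood that the supports of $f_0\circ A,f_1\circ A$ are contained in $[0,1]^2$. A single map $A$ is said to satisfy Assumption 2-(i) if it has these properties (inclusion, full visibility, derivative bounds). Assumption 3: for any $\alpha\in(0,1]$, $\mathcal A$ contains a finite subset $\mathcal A_{d_\alpha}$ such that for any $A\in\mathcal A$ there are $A'\in\mathcal A_{d_\alpha}$ and $j,\ell\in\{1,\dots,d\}$ such that $A'(\cdot+j/d,\cdot+\ell/d)$ satisfies Assumption 2-(i) and $\|A'(\cdot+\frac jd,\cdot+\frac\ell d)-A\|_\infty\le d^{-\alpha}$. Separation quantity: $D=D(f_0,f_1)\vee D(f_1,f_0)$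 with $D(f,g)=\inf_{a,s,s'\in\mathbb R,\,A,A'\in\mathcal A}\|a\,f\circ A(\cdot+s,\cdot+s')-g\circ A'\|_{L^2(\mathbb R^2)}/\|g\|_{L^2(\mathbb R^2)}$. CNN class. $\sigma(x)=\max\{x,0\}$, applied entrywise. For a $d\times d$ matrix $\mathbf W$, its quadratic support $[\mathbf W]$ (the filter) is the smallest square (contiguous) submatrix containing all non-zero entries of $\mathbf W$. If $[\mathbf W]$ is $\ell\times\ell$, let $\mathbf X'$ be the $(d+2\ell)\times(d+2\ell)$ matrix obtained by padding the $d\times d$ matrix $\mathbf X$ by $\ell$ rows/columns of zeros on all sides; $[\mathbf W]\star\mathbf X$ is the matrix whose $(i,j)$ entry is the sum of the entries of the Hadamard product of $[\mathbf W]$ with the $\ell\times\ell$ patch $(X'_{i+a,j+b})_{a,b=0,\dots,\ell-1}$, over all patches. $|\cdot|_\infty$ is the maximum absolute entry. For $\alpha\in(0,1)$ let $\mathcal K(i)=\{\lfloor d^{1-\alpha}+1\rfloor(i-1)+1,\dots,(\lfloor d^{1-\alpha}+1\rfloor i)\wedge d\}$; $\mathbf W$ has an $(\alpha,d)$-block structure if $W_{j,\ell}=W_{j',\ell'}$ whenever $j,j'\in\mathcal K(i)$, $\ell,\ell'\in\mathcal K(i')$ for some $i,i'$; every $d\times d$ matrix has a $(1,d)$-block structure. $\mathcal F^C(\alpha,r)$ is the class of maps $\mathbf X\mapsto(|\sigma([\mathbf W_s]\star\mathbf X)|_\infty)_{s=1,\dots,r}$ where each $\mathbf W_s$ has an $(\alpha,d)$-block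 structure and entries in $[-1,1]$. For $\mathbf v,\mathbf y\in\mathbb R^r$ let $\sigma_{\mathbf v}\mathbf y=(\sigma(y_1-v_1),\dots,\sigma(y_r-v_r))^\top$. Let $\Phi(x_1,x_2)=(\frac{e^{x_1}}{e^{x_1}+e^{x_2}},\frac{e^{x_2}}{e^{x_1}+e^{x_2}})$. $\mathcal F_\psi(L,\mathbf m)$, $\mathbf m=(m_0,\dots,m_{L+1})$, is the class of functions $\mathbf x\mapsto\psi\,\sigma_{\mathbf v_{L+1}}\mathbf W_L\sigma_{\mathbf v_L}\mathbf W_{L-1}\cdots\mathbf W_1\sigma_{\mathbf v_1}\mathbf W_0\mathbf x$ from $\mathbb R^{m_0}$ to $\mathbb R^{m_{L+1}}$ with weight matrices $\mathbf W_j\in\mathbb R^{m_{j+1}\times m_j}$ and bias vectors $\mathbf v_j\in\mathbb R^{m_j}$, all entries bounded by $1$ in absolute value, and $\psi$ the identity or $\Phi$. Finally $$\mathcal G(\alpha,m)=\{f\circ g:\ f\in\mathcal F_\Phi(1+2\lceil\log_2m\rceil,(2m,4m,\dots,4m,2)),\ g\in\mathcal F^C(\alpha,2m)\}.$$ *)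

theory Defs
  imports "HOL-Probability.Probability"
begin

text \<open>
  Points of the plane are pairs of reals. Since the resolution \<open>d\<close> and the layer widths vary
  inside the statement, a matrix is a function \<open>nat \<Rightarrow> nat \<Rightarrow> real\<close> and a vector a function
  \<open>nat \<Rightarrow> real\<close>; indices start at 1, and only entries with indices in the stated range
  (such as \<open>{1..d}\<close>) are ever used.
\<close>

type_synonym plane = "real \<times> real"
type_synonym matr = "nat \<Rightarrow> nat \<Rightarrow> real"
type_synonym vect = "nat \<Rightarrow> real"

abbreviation unit_square :: "plane set" where
  "unit_square \<equiv> {0..1} \<times> {0..1}"

subsection \<open>Norms and separation\<close>

definition L1_norm_unit :: "(plane \<Rightarrow> real) \<Rightarrow> real" where
  "L1_norm_unit h = (LINT z:unit_square|lborel. \<bar>h z\<bar>)"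

definition L2_norm_plane :: "(plane \<Rightarrow> real) \<Rightarrow> real" where
  "L2_norm_plane h = sqrt (LINT z|lborel. (h z)\<^sup>2)"

definition sup_norm_unit :: "(plane \<Rightarrow> plane) \<Rightarrow> real" where
  "sup_norm_unit A = max (SUP z\<in>unit_square. \<bar>fst (A z)\<bar>) (SUP z\<in>unit_square. \<bar>snd (A z)\<bar>)"

definition supp :: "(plane \<Rightarrow> real) \<Rightarrow> plane set" where
  "supp h = {z. h z \<noteq> 0}"

definition shift_map :: "real \<Rightarrow> real \<Rightarrow> (plane \<Rightarrow> plane) \<Rightarrow> plane \<Rightarrow> plane" where
  "shift_map s s' A = (\<lambda>(u, v). A (u + s, v + s'))"

definition sep_dir :: "(plane \<Rightarrow> plane) set \<Rightarrow> (plane \<Rightarrow> real) \<Rightarrow> (plane \<Rightarrow> real) \<Rightarrow> real" where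
  "sep_dir \<A> f g =
     Inf {L2_norm_plane (\<lambda>z. a * f (shift_map s s' A z) - g (A' z)) / L2_norm_plane g
          | a s s' A A'. A \<in> \<A> \<and> A' \<in> \<A>}"

definition separation :: "(plane \<Rightarrow> plane) set \<Rightarrow> (plane \<Rightarrow> real) \<Rightarrow> (plane \<Rightarrow> real) \<Rightarrow> real" where
  "separation \<A> f0 f1 = max (sep_dir \<A> f0 f1) (sep_dir \<A> f1 f0)"

subsection \<open>Assumptions on templates and deformations\<close>

text \<open>The two templates are \<open>f 0\<close> and \<open>f 1\<close>.\<close>

definition templates :: "(nat \<Rightarrow> plane \<Rightarrow> real) \<Rightarrow> bool" where
  "templates f \<longleftrightarrow> (\<forall>k\<in>{0,1}. (\<forall>z. 0 \<le> f k z) \<and> (\<exists>z. f k z \<noteq> 0))"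

definition assumption_1 :: "real \<Rightarrow> plane set \<Rightarrow> (nat \<Rightarrow> plane \<Rightarrow> real) \<Rightarrow> bool" where
  "assumption_1 C\<^sub>L R f \<longleftrightarrow>
     (\<exists>left right down up. R = {left..right} \<times> {down..up}) \<and> R \<subseteq> unit_square \<and>
     (\<forall>k\<in>{0,1}. supp (f k) \<subseteq> R \<and>
        (\<forall>u v u' v'. \<bar>f k (u, v) - f k (u', v')\<bar>
            \<le> C\<^sub>L * L1_norm_unit (f k) * (\<bar>u - u'\<bar> + \<bar>v - v'\<bar>)))"

definition C1_bounded :: "real \<Rightarrow> (plane \<Rightarrow> real) \<Rightarrow> bool" where
  "C1_bounded C a \<longleftrightarrow>
     (\<exists>g1 g2. continuous_on UNIV g1 \<and> continuous_on UNIV g2 \<and>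
        (\<forall>u v. ((\<lambda>t. a (t, v)) has_real_derivative g1 (u, v)) (at u) \<and>
               ((\<lambda>t. a (u, t)) has_real_derivative g2 (u, v)) (at v) \<and>
               \<bar>g1 (u, v)\<bar> \<le> C \<and> \<bar>g2 (u, v)\<bar> \<le> C))"

definition admissible_map ::
  "real \<Rightarrow> plane set \<Rightarrow> (nat \<Rightarrow> plane \<Rightarrow> real) \<Rightarrow> (plane \<Rightarrow> plane) \<Rightarrow> bool" where
  "admissible_map C\<^sub>A R f A \<longleftrightarrow>
     R \<subseteq> A ` unit_square \<and>
     (\<forall>k\<in>{0,1}. supp (f k \<circ> A) \<subseteq> unit_square) \<and>
     C1_bounded C\<^sub>A (fst \<circ> A) \<and> C1_bounded C\<^sub>A (snd \<circ> A)"

definition assumption_2i ::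
  "real \<Rightarrow> plane set \<Rightarrow> (nat \<Rightarrow> plane \<Rightarrow> real) \<Rightarrow> (plane \<Rightarrow> plane) set \<Rightarrow> bool" where
  "assumption_2i C\<^sub>A R f \<A> \<longleftrightarrow> id \<in> \<A> \<and> (\<forall>A\<in>\<A>. admissible_map C\<^sub>A R f A)"

text \<open>\<open>A_fin \<alpha>\<close> is the finite subset belonging to \<open>\<alpha>\<close> at the given resolution \<open>d\<close>.\<close>

definition assumption_3 ::
  "nat \<Rightarrow> real \<Rightarrow> plane set \<Rightarrow> (nat \<Rightarrow> plane \<Rightarrow> real) \<Rightarrow> (plane \<Rightarrow> plane) set
     \<Rightarrow> (real \<Rightarrow> (plane \<Rightarrow> plane) set) \<Rightarrow> bool" where
  "assumption_3 d C\<^sub>A R f \<A> A_fin \<longleftrightarrow>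
     (\<forall>\<alpha>. 0 < \<alpha> \<and> \<alpha> \<le> 1 \<longrightarrow>
        A_fin \<alpha> \<subseteq> \<A> \<and> finite (A_fin \<alpha>) \<and>
        (\<forall>A\<in>\<A>. \<exists>A'\<in>A_fin \<alpha>. \<exists>j\<in>{1..d}. \<exists>l\<in>{1..d}.
           admissible_map C\<^sub>A R f (shift_map (real j / real d) (real l / real d) A') \<and>
           sup_norm_unit (\<lambda>z. shift_map (real j / real d) (real l / real d) A' z - A z)
             \<le> real d powr (- \<alpha>)))"

subsection \<open>Data distribution\<close>

definition pixel :: "nat \<Rightarrow> nat \<Rightarrow> nat \<Rightarrow> plane set" where
  "pixel d j l =
     {(real j - 1) / real d ..< real j / real d} \<times> {(real l - 1) / real d ..< real l / real d}"

definition image_of :: "nat \<Rightarrow> (plane \<Rightarrow> real) \<Rightarrow> (plane \<Rightarrow> plane) \<Rightarrow> real \<Rightarrow> matr" where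
  "image_of d h A \<eta> = (\<lambda>j l. (real d)\<^sup>2 * \<eta> * (LINT z:pixel d j l|lborel. h (A z)))"

definition normalized :: "nat \<Rightarrow> matr \<Rightarrow> matr" where
  "normalized d X = (\<lambda>j l. X j l / sqrt (\<Sum>j'=1..d. \<Sum>l'=1..d. (X j' l')\<^sup>2))"

text \<open>
  \<open>P\<close> is the joint law of the triple \<open>(k, A, \<eta>)\<close>; the random pair is \<open>(image_of d (f k) A \<eta>, k)\<close>.
  The \<open>\<sigma>\<close>-algebra of \<open>QA\<close> is arbitrary, as long as point evaluations (hence the
  pixel values) are measurable. The law of \<open>(A, \<eta>)\<close> being the product measure is the
  independence of \<open>A\<close> and \<open>\<eta>\<close>; the dependence between \<open>k\<close> and \<open>(A, \<eta>)\<close> is not restricted.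
\<close>

definition data_model ::
  "(plane \<Rightarrow> plane) set \<Rightarrow> real \<Rightarrow> (plane \<Rightarrow> plane) measure \<Rightarrow> real measure
     \<Rightarrow> (nat \<times> (plane \<Rightarrow> plane) \<times> real) measure \<Rightarrow> bool" where
  "data_model \<A> q QA Q\<eta> P \<longleftrightarrow>
     0 \<le> q \<and> q \<le> 1 \<and>
     prob_space QA \<and> space QA = \<A> \<and> (\<forall>z. (\<lambda>A. A z) \<in> borel_measurable QA) \<and>
     prob_space Q\<eta> \<and> sets Q\<eta> = sets (restrict_space borel {0<..}) \<and>
     prob_space P \<and> sets P = sets (count_space UNIV \<Otimes>\<^sub>M (QA \<Otimes>\<^sub>M Q\<eta>)) \<and>
     distr P (count_space UNIV) fst = measure_pmf (map_pmf of_bool (bernoulli_pmf q)) \<and>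
     distr P (QA \<Otimes>\<^sub>M Q\<eta>) snd = QA \<Otimes>\<^sub>M Q\<eta>"

subsection \<open>Networks\<close>

definition relu :: "real \<Rightarrow> real" where
  "relu x = max x 0"

definition covers_nonzero :: "nat \<Rightarrow> matr \<Rightarrow> nat \<Rightarrow> nat \<times> nat \<Rightarrow> bool" where
  "covers_nonzero d W n = (\<lambda>(i0, j0). i0 + n \<le> d \<and> j0 + n \<le> d \<and>
     (\<forall>i\<in>{1..d}. \<forall>j\<in>{1..d}. W i j \<noteq> 0 \<longrightarrow> i \<in> {i0+1..i0+n} \<and> j \<in> {j0+1..j0+n}))"

definition filter_size :: "nat \<Rightarrow> matr \<Rightarrow> nat" where
  "filter_size d W = (LEAST n. \<exists>pos. covers_nonzero d W n pos)"

text \<open>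
  The smallest square submatrix need not be unique. The choice is immaterial: because of the
  padding, the patches realise every relative position in which non-zero filter entries
  meet the image, so the maximum in \<open>cnn_feature\<close> is the same for all choices.
\<close>

definition quadratic_support :: "nat \<Rightarrow> matr \<Rightarrow> matr" where
  "quadratic_support d W =
     (let (i0, j0) = (SOME pos. covers_nonzero d W (filter_size d W) pos)
      in (\<lambda>a b. W (i0 + a) (j0 + b)))"

definition zero_padded :: "nat \<Rightarrow> nat \<Rightarrow> matr \<Rightarrow> matr" where
  "zero_padded d n X =
     (\<lambda>i j. if i \<in> {n+1..n+d} \<and> j \<in> {n+1..n+d} then X (i - n) (j - n) else 0)"

text \<open>
  The padded matrix has \<open>d + 2 * n\<close> rows and columns, so the top left corners \<open>(i, j)\<close> of
  its \<open>n \<times> n\<close> patches range over \<open>i, j \<in> {1..d + n + 1}\<close>.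
\<close>

definition convolve :: "nat \<Rightarrow> matr \<Rightarrow> matr \<Rightarrow> matr" where
  "convolve d W X = (let n = filter_size d W in
     (\<lambda>i j. \<Sum>a<n. \<Sum>b<n.
        quadratic_support d W (a + 1) (b + 1) * zero_padded d n X (i + a) (j + b)))"

definition max_abs_entry :: "nat \<Rightarrow> matr \<Rightarrow> real" where
  "max_abs_entry n Y = Max ((\<lambda>(i, j). \<bar>Y i j\<bar>) ` ({1..n} \<times> {1..n}))"

definition cnn_feature :: "nat \<Rightarrow> matr \<Rightarrow> matr \<Rightarrow> real" where
  "cnn_feature d W X =
     max_abs_entry (d + filter_size d W + 1) (\<lambda>i j. relu (convolve d W X i j))"

definition block :: "real \<Rightarrow> nat \<Rightarrow> nat \<Rightarrow> nat set" where
  "block \<alpha> d i = (let b = nat \<lfloor>real d powr (1 - \<alpha>) + 1\<rfloor> in {b * (i - 1) + 1..min (b * i) d})"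

definition block_structure :: "real \<Rightarrow> nat \<Rightarrow> matr \<Rightarrow> bool" where
  "block_structure \<alpha> d W \<longleftrightarrow> \<alpha> = 1 \<or>
     (\<forall>i\<ge>1. \<forall>i'\<ge>1. \<forall>j\<in>block \<alpha> d i. \<forall>j'\<in>block \<alpha> d i. \<forall>l\<in>block \<alpha> d i'. \<forall>l'\<in>block \<alpha> d i'.
        W j l = W j' l')"

definition cnn_class :: "nat \<Rightarrow> real \<Rightarrow> nat \<Rightarrow> (matr \<Rightarrow> vect) set" where
  "cnn_class d \<alpha> r =
     {(\<lambda>X s. cnn_feature d (W s) X) | W.
        \<forall>s\<in>{1..r}. block_structure \<alpha> d (W s) \<and> (\<forall>i\<in>{1..d}. \<forall>j\<in>{1..d}. \<bar>W s i j\<bar> \<le> 1)}"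

definition mat_vec :: "nat \<Rightarrow> matr \<Rightarrow> vect \<Rightarrow> vect" where
  "mat_vec n W x = (\<lambda>i. \<Sum>j=1..n. W i j * x j)"

definition shifted_relu :: "vect \<Rightarrow> vect \<Rightarrow> vect" where
  "shifted_relu v y = (\<lambda>i. relu (y i - v i))"

primrec layers :: "nat list \<Rightarrow> (nat \<Rightarrow> matr) \<Rightarrow> (nat \<Rightarrow> vect) \<Rightarrow> nat \<Rightarrow> vect \<Rightarrow> vect" where
  "layers ms W v 0 x = x"
| "layers ms W v (Suc n) x = shifted_relu (v (Suc n)) (mat_vec (ms ! n) (W n) (layers ms W v n x))"

text \<open>\<open>ms\<close> is the width vector \<open>(m\<^sub>0, \<dots>, m\<^sub>L\<^sub>+\<^sub>1)\<close>, of length \<open>L + 2\<close>.\<close>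

definition network_class :: "(vect \<Rightarrow> vect) \<Rightarrow> nat \<Rightarrow> nat list \<Rightarrow> (vect \<Rightarrow> vect) set" where
  "network_class \<psi> L ms =
     {(\<lambda>x. \<psi> (layers ms W v (L + 1) x)) | W v.
        (\<forall>j\<le>L. \<forall>i\<in>{1..ms ! (j + 1)}. \<forall>l\<in>{1..ms ! j}. \<bar>W j i l\<bar> \<le> 1) \<and>
        (\<forall>j\<in>{1..L + 1}. \<forall>i\<in>{1..ms ! j}. \<bar>v j i\<bar> \<le> 1)}"

definition softmax2 :: "vect \<Rightarrow> vect" where
  "softmax2 x = (\<lambda>i. exp (x i) / (exp (x 1) + exp (x 2)))"

definition classifier_nets :: "nat \<Rightarrow> real \<Rightarrow> nat \<Rightarrow> (matr \<Rightarrow> vect) set" where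
  "classifier_nets d \<alpha> m =
     (let L = 1 + 2 * nat \<lceil>log 2 (real m)\<rceil> in
      {f \<circ> g | f g. f \<in> network_class softmax2 L ([2 * m] @ replicate L (4 * m) @ [2]) \<and>
                   g \<in> cnn_class d \<alpha> (2 * m)})"

definition predicted_label :: "nat \<Rightarrow> (matr \<Rightarrow> vect) \<Rightarrow> matr \<Rightarrow> nat" where
  "predicted_label d p X = of_bool (p (normalized d X) 2 > 1 / 2)"

end

(*
The normalised image and the normalised filters are unit vectors, and a feature is the largest cosine
between the image and a translate of the filter. Take as filters the block samples of all f_i o A'
with A' in the finite class. Block sampling and pixel averaging each change a Lipschitz function
by O(d^-alpha) in sup norm; since the cosine of two unit vectors at distance r is 1 - r^2/2, the
filter closest to the true deformation has feature at least 1 - K d^-alpha. For a filter of the wrong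
class, rescaling one side by the optimal factor turns the separation hypothesis into
1 - cos^2 >= c kappa d^-alpha, so its feature is at most 1 - 2 K d^-alpha once kappa is large. As cosine
is symmetric, it does not matter which of the two directions realises the separation quantity.
The network then needs no maximum over the filters: subtract the threshold 1 - 2 K d^-alpha, apply
the rectifier, and sum over each class; only the sum of the true class is positive.
*)
theory Submission
  imports Defs
begin

subsection \<open>Pixel grid functions\<close>

text \<open>Filters and images are compared as functions in L2 of the plane. Spreading a matrix over
  the pixels is an isometry up to the factor \<open>d\<close>, and a translation by whole pixels
  stays among such functions, so correlations at integer shifts become L2 inner products. Both
  \<open>separation\<close> and \<open>assumption_3\<close> allow these translations, hence the
  continuous hypotheses pass to matrices at the price of the discretisation error alone. Two
  obstacles shape the constants. The estimates need d^-alpha small, but no lower bound on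
  \<open>d\<close> is given: taking a = 0 shows D <= 1, so the separation hypothesis itself forces
  kappa d^-alpha <= 1, and a large kappa supplies the smallness. Moreover kappa may not depend on
  the templates: Lipschitz constants, accuracies and lower bounds for the norms are all proportional
  to the mass of the template, so the masses cancel from every cosine estimate, even when the two
  templates have different ones.\<close>

definition grid :: "nat \<Rightarrow> (int \<Rightarrow> int \<Rightarrow> real) \<Rightarrow> plane \<Rightarrow> real" where
  "grid d Y z = Y (\<lfloor>real d * fst z\<rfloor> + 1) (\<lfloor>real d * snd z\<rfloor> + 1)"

definition box_supported :: "nat \<Rightarrow> (int \<Rightarrow> int \<Rightarrow> real) \<Rightarrow> bool" where
  "box_supported d Y \<longleftrightarrow> (\<forall>i j. (i, j) \<notin> {1..int d} \<times> {1..int d} \<longrightarrow> Y i j = 0)"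

definition box_sum :: "nat \<Rightarrow> (int \<Rightarrow> int \<Rightarrow> real) \<Rightarrow> real" where
  "box_sum d Y = (\<Sum>(i, j)\<in>{1..int d} \<times> {1..int d}. Y i j)"

text \<open>Up to the factor d^2, this is the L2 inner product of two grid functions, one translated
  by \<open>(s, s')\<close> pixels. Integer indices admit shifts of either sign; summing over the
  box loses nothing when \<open>Y\<close> is \<open>box_supported\<close>.\<close>

definition corr :: "nat \<Rightarrow> (int \<Rightarrow> int \<Rightarrow> real) \<Rightarrow> (int \<Rightarrow> int \<Rightarrow> real) \<Rightarrow> int \<Rightarrow> int \<Rightarrow> real" where
  "corr d Y X s s' = box_sum d (\<lambda>i j. Y i j * X (i - s) (j - s'))"

lemma box_supportedD:
  "box_supported d Y \<Longrightarrow> Y i j \<noteq> 0 \<Longrightarrow> 1 \<le> i \<and> i \<le> int d \<and> 1 \<le> j \<and> j \<le> int d"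
  by (auto simp: box_supported_def)

lemma has_integral_indicator_rectangle:
  fixes a b a' b' :: real
  assumes "a \<le> b" "a' \<le> b'"
  shows "has_bochner_integral lborel (indicator ({a..<b} \<times> {a'..<b'}) :: plane \<Rightarrow> real) ((b - a) * (b' - a'))"
    and "has_bochner_integral lborel (indicator ({a..b} \<times> {a'..b'}) :: plane \<Rightarrow> real) ((b - a) * (b' - a'))"
proof -
  have 1: "emeasure lborel ({a..<b} \<times> {a'..<b'}) = ennreal ((b - a) * (b' - a'))"
    using assms by (simp add: lborel_prod[symmetric] lborel.emeasure_pair_measure_Times ennreal_mult)
  have 2: "emeasure lborel ({a..b} \<times> {a'..b'}) = ennreal ((b - a) * (b' - a'))"
    using assms by (simp add: lborel_prod[symmetric] lborel.emeasure_pair_measure_Times ennreal_mult)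
  have s1: "{a..<b} \<times> {a'..<b'} \<in> sets lborel" and s2: "{a..b} \<times> {a'..b'} \<in> sets lborel"
    by (auto simp: borel_prod[symmetric])
  show "has_bochner_integral lborel (indicator ({a..<b} \<times> {a'..<b'}) :: plane \<Rightarrow> real) ((b - a) * (b' - a'))"
    using has_bochner_integral_real_indicator[OF s1] 1 assms by (simp add: measure_def)
  show "has_bochner_integral lborel (indicator ({a..b} \<times> {a'..b'}) :: plane \<Rightarrow> real) ((b - a) * (b' - a'))"
    using has_bochner_integral_real_indicator[OF s2] 2 assms by (simp add: measure_def)
qed

lemma floor_pixel_iff:
  assumes "d \<ge> 1"
  shows "\<lfloor>real d * x\<rfloor> + 1 = i \<longleftrightarrow> x \<in> {(of_int i - 1) / real d..<of_int i / real d}"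
proof -
  have "real d > 0" using assms by simp
  then show ?thesis
    by (auto simp: field_simps) linarith+
qed

lemma has_integral_grid:
  assumes d: "d \<ge> 1" and Y: "box_supported d Y"
  shows "has_bochner_integral lborel (\<lambda>z. grid d Y (z + c)) (box_sum d Y / (real d)\<^sup>2)"
proof -
  let ?B = "{1..int d} \<times> {1..int d}"
  let ?I = "\<lambda>i c. {(of_int i - 1) / real d - c..<of_int i / real d - c}"
  \<comment> \<open>Half-open pixels tile the plane, so only the pixel \<open>(i0, j0)\<close>
    containing the shifted point contributes. If it lies outside the box, both sides are 0.\<close>
  have eq: "grid d Y (z + c) =
      (\<Sum>(i, j)\<in>?B. Y i j * indicator (?I i (fst c) \<times> ?I j (snd c)) z)" for z
  proof -
    define i0 j0 where "i0 = \<lfloor>real d * (fst z + fst c)\<rfloor> + 1" and "j0 = \<lfloor>real d * (snd z + snd c)\<rfloor> + 1"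
    have "i0 = i \<longleftrightarrow> fst z + fst c \<in> {(of_int i - 1) / real d..<of_int i / real d}" for i
      unfolding i0_def using floor_pixel_iff[OF d] by blast
    then have I: "fst z \<in> ?I i (fst c) \<longleftrightarrow> i = i0" for i
      by (simp add: diff_le_eq less_diff_eq eq_commute[of i i0])
    have "j0 = i \<longleftrightarrow> snd z + snd c \<in> {(of_int i - 1) / real d..<of_int i / real d}" for i
      unfolding j0_def using floor_pixel_iff[OF d] by blast
    then have J: "snd z \<in> ?I i (snd c) \<longleftrightarrow> i = j0" for i
      by (simp add: diff_le_eq less_diff_eq eq_commute[of i j0])
    have "(\<Sum>(i, j)\<in>?B. Y i j * indicator (?I i (fst c) \<times> ?I j (snd c)) z)
        = (\<Sum>p\<in>?B. if p = (i0, j0) then Y i0 j0 else 0)"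
      using I J by (intro sum.cong refl) (auto simp: indicator_def mem_Times_iff split: prod.splits)
    also have "\<dots> = (if (i0, j0) \<in> ?B then Y i0 j0 else 0)"
      by (subst sum.delta) auto
    also have "\<dots> = Y i0 j0"
      using Y by (simp add: box_supported_def)
    finally show ?thesis by (simp add: grid_def i0_def j0_def)
  qed
  have "has_bochner_integral lborel (\<lambda>z. \<Sum>p\<in>?B. Y (fst p) (snd p) * indicator (?I (fst p) (fst c) \<times> ?I (snd p) (snd c)) z)
     (\<Sum>p\<in>?B. Y (fst p) (snd p) * ((1 / real d) * (1 / real d)))"
  proof (intro has_bochner_integral_sum has_bochner_integral_mult_right)
    fix p :: "int \<times> int"
    have le: "(of_int i - 1) / real d - c \<le> of_int i / real d - c" for i c by (simp add: divide_right_mono)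
    have df: "of_int i / real d - c - ((of_int i - 1) / real d - c) = 1 / real d" for i c by (simp add: diff_divide_distrib)
    show "has_bochner_integral lborel (indicator (?I (fst p) (fst c) \<times> ?I (snd p) (snd c))) ((1 / real d) * (1 / real d))"
      using has_integral_indicator_rectangle(1)[OF le[of "fst p" "fst c"] le[of "snd p" "snd c"]] by (simp only: df)
  qed
  moreover have "(\<Sum>p\<in>?B. Y (fst p) (snd p) * ((1 / real d) * (1 / real d))) = box_sum d Y / (real d)\<^sup>2"
    by (simp add: box_sum_def sum_divide_distrib case_prod_beta power2_eq_square)
  ultimately show ?thesis
    by (simp add: eq case_prod_beta)
qed

lemma grid_shift:
  assumes "d \<ge> 1"
  shows "grid d Y (z + (of_int s / real d, of_int s' / real d)) = grid d (\<lambda>i j. Y (i + s) (j + s')) z"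
proof -
  have "\<lfloor>real d * (x + of_int s / real d)\<rfloor> = \<lfloor>real d * x\<rfloor> + s" for x s
    using assms by (simp add: distrib_left)
  then show ?thesis by (simp add: grid_def add_ac)
qed

text \<open>After a translation by whole pixels the product of two grid functions is again a grid
  function, so the squared L2 distance expands as for Euclidean vectors, with \<open>corr\<close> as
  the inner product.\<close>

lemma has_integral_grid_diff_square:
  fixes a :: real and s s' :: int
  assumes d: "d \<ge> 1" and Y: "box_supported d Y" and X: "box_supported d X"
  defines "c \<equiv> (of_int s / real d, of_int s' / real d)"
  shows "has_bochner_integral lborel (\<lambda>z. (a * grid d Y (z + c) - grid d X z)\<^sup>2)
     ((a\<^sup>2 * box_sum d (\<lambda>i j. (Y i j)\<^sup>2) - 2 * a * corr d Y X s s' + box_sum d (\<lambda>i j. (X i j)\<^sup>2)) / (real d)\<^sup>2)"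
proof -
  have Y2: "has_bochner_integral lborel (\<lambda>z. (grid d Y (z + c))\<^sup>2) (box_sum d (\<lambda>i j. (Y i j)\<^sup>2) / (real d)\<^sup>2)"
    using has_integral_grid[OF d, of "\<lambda>i j. (Y i j)\<^sup>2" c] Y by (simp add: grid_def box_supported_def)
  have X2: "has_bochner_integral lborel (\<lambda>z. (grid d X z)\<^sup>2) (box_sum d (\<lambda>i j. (X i j)\<^sup>2) / (real d)\<^sup>2)"
    using has_integral_grid[OF d, of "\<lambda>i j. (X i j)\<^sup>2" 0] X by (simp add: grid_def box_supported_def)
  have "grid d (\<lambda>i j. Y i j * X (i - s) (j - s')) (z + c) = grid d Y (z + c) * grid d X z" for z
    unfolding c_def grid_shift[OF d] by (simp add: grid_def)
  then have YX: "has_bochner_integral lborel (\<lambda>z. grid d Y (z + c) * grid d X z) (corr d Y X s s' / (real d)\<^sup>2)"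
    using has_integral_grid[OF d, of "\<lambda>i j. Y i j * X (i - s) (j - s')" c] Y
    by (simp add: box_supported_def corr_def)
  have "has_bochner_integral lborel
      (\<lambda>z. a\<^sup>2 * (grid d Y (z + c))\<^sup>2 - 2 * a * (grid d Y (z + c) * grid d X z) + (grid d X z)\<^sup>2)
     (a\<^sup>2 * (box_sum d (\<lambda>i j. (Y i j)\<^sup>2) / (real d)\<^sup>2) - 2 * a * (corr d Y X s s' / (real d)\<^sup>2)
        + box_sum d (\<lambda>i j. (X i j)\<^sup>2) / (real d)\<^sup>2)"
    by (intro has_bochner_integral_add has_bochner_integral_diff has_bochner_integral_mult_right Y2 X2 YX)
  then show ?thesis
    by (simp add: power2_diff power_mult_distrib add_divide_distrib diff_divide_distrib algebra_simps)
qed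

text \<open>Needed to exchange filter and image when the separation quantity is realised in the
  opposite direction. Only index pairs with both members in the box contribute, and translation
  matches these.\<close>

lemma corr_commute:
  assumes Y: "box_supported d Y" and X: "box_supported d X"
  shows "corr d X Y (- s) (- s') = corr d Y X s s'"
proof -
  let ?B = "{1..int d} \<times> {1..int d}"
  have "corr d X Y (- s) (- s') = (\<Sum>(i, j)\<in>{(i, j). (i, j) \<in> ?B \<and> (i + s, j + s') \<in> ?B}. X i j * Y (i + s) (j + s'))"
    unfolding corr_def box_sum_def
    by (intro sum.mono_neutral_cong_right) (auto dest: box_supportedD[OF Y])
  also have "\<dots> = (\<Sum>(i, j)\<in>{(i, j). (i, j) \<in> ?B \<and> (i - s, j - s') \<in> ?B}. Y i j * X (i - s) (j - s'))"
    by (rule sum.reindex_bij_witness[of _ "\<lambda>(i, j). (i - s, j - s')" "\<lambda>(i, j). (i + s, j + s')"]) auto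
  also have "\<dots> = corr d Y X s s'"
    unfolding corr_def box_sum_def
    by (intro sum.mono_neutral_cong_left) (auto dest: box_supportedD[OF X])
  finally show ?thesis .
qed

subsection \<open>Networks and features\<close>

definition zext :: "nat \<Rightarrow> matr \<Rightarrow> int \<Rightarrow> int \<Rightarrow> real" where
  "zext d W i j = (if (i, j) \<in> {1..int d} \<times> {1..int d} then W (nat i) (nat j) else 0)"

lemma box_supported_zext: "box_supported d (zext d W)"
  by (auto simp: box_supported_def zext_def)

lemma box_sum_nat:
  "box_sum d Y = (\<Sum>(i, j)\<in>{1..d} \<times> {1..d}. Y (int i) (int j))"
  unfolding box_sum_def
  by (rule sum.reindex_bij_witness[of _ "\<lambda>(i, j). (int i, int j)" "\<lambda>(i, j). (nat i, nat j)"]) auto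

lemma filter_size_covers:
  obtains i0 j0 where "covers_nonzero d W (filter_size d W) (i0, j0)"
    and "quadratic_support d W = (\<lambda>a b. W (i0 + a) (j0 + b))"
proof -
  have "covers_nonzero d W d (0, 0)"
    by (auto simp: covers_nonzero_def)
  then have "\<exists>pos. covers_nonzero d W (filter_size d W) pos"
    unfolding filter_size_def using LeastI[of "\<lambda>n. \<exists>pos. covers_nonzero d W n pos" d] by blast
  then have "covers_nonzero d W (filter_size d W) (SOME pos. covers_nonzero d W (filter_size d W) pos)"
    by (rule someI_ex)
  then show ?thesis
    using that by (cases "SOME pos. covers_nonzero d W (filter_size d W) pos") (auto simp: quadratic_support_def)
qed

text \<open>Filter row p = i0 + a + 1 meets image row i + a - n, where n is the filter size. Their
  difference is n + i0 + 1 - i for every a, so each patch computes a correlation at one shift.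
  Restricting to the quadratic support drops only zeros, and padding plays the part of
  \<open>zext\<close>.\<close>

lemma convolve_eq_corr:
  obtains i0 j0 where "covers_nonzero d W (filter_size d W) (i0, j0)"
    and "\<And>X i j. convolve d W X i j =
      corr d (zext d W) (zext d X) (int (filter_size d W + i0 + 1) - int i) (int (filter_size d W + j0 + 1) - int j)"
proof -
  define n where "n = filter_size d W"
  obtain i0 j0 where cov: "covers_nonzero d W n (i0, j0)"
    and qs: "quadratic_support d W = (\<lambda>a b. W (i0 + a) (j0 + b))"
    unfolding n_def by (rule filter_size_covers)
  have "convolve d W X i j = corr d (zext d W) (zext d X) (int (n + i0 + 1) - int i) (int (n + j0 + 1) - int j)" for X i j
  proof -
    let ?g = "\<lambda>p q. W p q * zext d X (int p - (int (n + i0 + 1) - int i)) (int q - (int (n + j0 + 1) - int j))"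
    have "convolve d W X i j = (\<Sum>(a, b)\<in>{..<n} \<times> {..<n}. ?g (i0 + (a + 1)) (j0 + (b + 1)))"
      unfolding convolve_def Let_def n_def[symmetric] sum.cartesian_product qs
      by (intro sum.cong refl)
         (auto simp: zero_padded_def zext_def nat_add_distrib nat_diff_distrib' algebra_simps of_nat_diff
            intro!: arg_cong2[of _ _ _ _ X])
    also have "\<dots> = (\<Sum>(p, q)\<in>{i0+1..i0+n} \<times> {j0+1..j0+n}. ?g p q)"
      by (rule sum.reindex_bij_witness[of _ "\<lambda>(p, q). (p - i0 - 1, q - j0 - 1)" "\<lambda>(a, b). (i0 + (a + 1), j0 + (b + 1))"]) auto
    also have "\<dots> = (\<Sum>(p, q)\<in>{1..d} \<times> {1..d}. ?g p q)"
      using cov by (intro sum.mono_neutral_left) (auto simp: covers_nonzero_def)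
    also have "\<dots> = corr d (zext d W) (zext d X) (int (n + i0 + 1) - int i) (int (n + j0 + 1) - int j)"
      unfolding corr_def box_sum_nat by (intro sum.cong refl) (auto simp: zext_def)
    finally show ?thesis .
  qed
  with cov show ?thesis using that unfolding n_def by blast
qed

lemma corr_eq_0:
  assumes "\<And>i j. 1 \<le> i \<Longrightarrow> i \<le> int d \<Longrightarrow> 1 \<le> j \<Longrightarrow> j \<le> int d \<Longrightarrow> Y i j = 0 \<or> X (i - s) (j - s') = 0"
  shows "corr d Y X s s' = 0"
  unfolding corr_def box_sum_def using assms by (intro sum.neutral) fastforce

text \<open>The patches realise only finitely many shifts. At any other shift the non-zero part of
  the filter misses the image, so the correlation is 0 and lies below the feature, which is
  nonnegative by rectification.\<close>

lemma cnn_feature_ge: "corr d (zext d W) (zext d X) s s' \<le> cnn_feature d W X"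
proof -
  define n where "n = filter_size d W"
  obtain i0 j0 where cov: "covers_nonzero d W n (i0, j0)"
    and eq: "\<And>X i j. convolve d W X i j =
      corr d (zext d W) (zext d X) (int (n + i0 + 1) - int i) (int (n + j0 + 1) - int j)"
    unfolding n_def by (rule convolve_eq_corr) blast
  let ?f = "\<lambda>(i, j). \<bar>relu (convolve d W X i j)\<bar>"
  have feat: "cnn_feature d W X = Max (?f ` ({1..d+n+1} \<times> {1..d+n+1}))"
    by (simp add: cnn_feature_def max_abs_entry_def n_def case_prod_beta)
  have ge: "?f (i, j) \<le> cnn_feature d W X" if "i \<in> {1..d+n+1}" "j \<in> {1..d+n+1}" for i j
    unfolding feat using that by (intro Max_ge) auto
  have nonneg: "0 \<le> cnn_feature d W X"
    using ge[of 1 1] by auto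
  define i j where "i = int (n + i0 + 1) - s" and "j = int (n + j0 + 1) - s'"
  show ?thesis
  proof (cases "i \<in> {1..int (d+n+1)} \<and> j \<in> {1..int (d+n+1)}")
    case True
    then have "convolve d W X (nat i) (nat j) = corr d (zext d W) (zext d X) s s'"
      by (simp add: eq i_def j_def)
    moreover have "convolve d W X (nat i) (nat j) \<le> ?f (nat i, nat j)"
      by (simp add: relu_def)
    ultimately show ?thesis
      using ge[of "nat i" "nat j"] True by (auto simp: nat_le_iff Suc_le_eq)
  next
    case False
    have "corr d (zext d W) (zext d X) s s' = 0"
    proof (rule corr_eq_0)
      fix p q assume pq: "1 \<le> p" "p \<le> int d" "1 \<le> q" "q \<le> int d"
      show "zext d W p q = 0 \<or> zext d X (p - s) (q - s') = 0"
      proof (rule ccontr)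
        assume "\<not> ?thesis"
        then have W: "W (nat p) (nat q) \<noteq> 0" and X: "zext d X (p - s) (q - s') \<noteq> 0"
          using pq by (auto simp: zext_def)
        have "nat p \<in> {1..d}" "nat q \<in> {1..d}"
          using pq by auto
        then have "nat p \<in> {i0+1..i0+n} \<and> nat q \<in> {j0+1..j0+n}" and "i0 + n \<le> d" "j0 + n \<le> d"
          using cov W unfolding covers_nonzero_def by blast+
        moreover have "1 \<le> p - s" "p - s \<le> int d" "1 \<le> q - s'" "q - s' \<le> int d"
          using box_supportedD[OF box_supported_zext X] by auto
        ultimately show False
          using False pq unfolding i_def j_def by auto
      qed
    qed
    with nonneg show ?thesis by simp
  qed
qed

lemma cnn_feature_le:
  assumes B: "0 \<le> B" and corr: "\<And>s s'. corr d (zext d W) (zext d X) s s' \<le> B"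
  shows "cnn_feature d W X \<le> B"
proof -
  obtain i0 j0 where eq: "\<And>X i j. convolve d W X i j =
      corr d (zext d W) (zext d X) (int (filter_size d W + i0 + 1) - int i) (int (filter_size d W + j0 + 1) - int j)"
    by (rule convolve_eq_corr) blast
  show ?thesis
    unfolding cnn_feature_def max_abs_entry_def
    using B corr by (intro Max.boundedI) (auto simp: relu_def eq)
qed

text \<open>The first layer thresholds the features, all further hidden layers are identities, and the
  last one adds up each half.\<close>

lemma threshold_network:
  assumes t: "\<bar>t\<bar> \<le> 1" and L: "L \<ge> 1"
  obtains \<phi> where "\<phi> \<in> network_class softmax2 L ([2 * m] @ replicate L (4 * m) @ [2])"
    and "\<And>x. \<phi> x 2 > 1 / 2 \<longleftrightarrow> (\<Sum>i=1..m. relu (x i - t)) < (\<Sum>i=m+1..2*m. relu (x i - t))"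
proof -
  let ?ms = "[2 * m] @ replicate L (4 * m) @ [2]"
  \<comment> \<open>Hidden layers have 4m neurons but only 2m features are carried along. Neurons
    beyond 2m may be active through the bias, yet all their outgoing weights are 0.\<close>
  define W :: "nat \<Rightarrow> matr" where "W = (\<lambda>n i l. if n = L then of_bool (l \<in> (if i = 1 then {1..m} else {m+1..2*m})) else of_bool (i = l \<and> l \<le> 2 * m))"
  define v :: "nat \<Rightarrow> vect" where "v = (\<lambda>n i. if n = 1 then t else 0)"
  have hid: "?ms ! n = 4 * m" if "1 \<le> n" "n \<le> L" for n
    using that by (auto simp: nth_append nth_Cons split: nat.splits)
  have layer: "layers ?ms W v n x i = relu (x i - t)"
    if "1 \<le> n" "n \<le> L" "i \<in> {1..2*m}" for n x i
    using that
  proof (induction n arbitrary: i)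
    case (Suc n)
    show ?case
    proof (cases "n = 0")
      case True
      with Suc L have "W 0 i l * x l = (if l = i then x i else 0)" for l
        by (auto simp: W_def)
      with True Suc show ?thesis
        by (simp add: shifted_relu_def mat_vec_def v_def)
    next
      case False
      with Suc have "W n i l * layers ?ms W v n x l = (if l = i then relu (x i - t) else 0)" for l
        by (auto simp: W_def)
      with False Suc hid[of n] show ?thesis
        by (simp add: shifted_relu_def mat_vec_def v_def relu_def del: append_Cons)
    qed
  qed simp
  have out: "layers ?ms W v (L + 1) x i = (\<Sum>l\<in>(if i = 1 then {1..m} else {m+1..2*m}). relu (x l - t))" for x i
  proof -
    let ?S = "if i = 1 then {1..m} else {m+1..2*m}"
    have "mat_vec (4 * m) (W L) (layers ?ms W v L x) i = (\<Sum>l\<in>?S. layers ?ms W v L x l)"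
      unfolding mat_vec_def by (rule sum.mono_neutral_cong_right) (auto simp: W_def split: if_splits)
    also have "\<dots> = (\<Sum>l\<in>?S. relu (x l - t))"
      using L by (intro sum.cong refl layer) (auto split: if_splits)
    moreover have "relu (\<Sum>l\<in>?S. relu (x l - t)) = (\<Sum>l\<in>?S. relu (x l - t))"
      unfolding relu_def by (intro max_absorb1 sum_nonneg) auto
    ultimately show ?thesis
      using L hid[of L] by (simp add: shifted_relu_def v_def del: append_Cons)
  qed
  show ?thesis
  proof (rule that)
    show "(\<lambda>x. softmax2 (layers ?ms W v (L + 1) x)) \<in> network_class softmax2 L ?ms"
      unfolding network_class_def using t by (intro CollectI exI[of _ W] exI[of _ v]) (auto simp: W_def v_def)
    show "softmax2 (layers ?ms W v (L + 1) x) 2 > 1 / 2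
        \<longleftrightarrow> (\<Sum>i=1..m. relu (x i - t)) < (\<Sum>i=m+1..2*m. relu (x i - t))" for x
    proof -
      have "1 / 2 < exp b / (exp a + exp b) \<longleftrightarrow> a < b" for a b :: real
        by (simp add: field_simps add_pos_pos)
      then show ?thesis
        unfolding softmax2_def out by simp
    qed
  qed
qed

subsection \<open>Approximation by grid functions\<close>

text \<open>The indicator confines a sup-norm error to a set of area 1, so \<delta> also bounds the
  L2 error over the whole plane, before and after any translation.\<close>

definition approximates :: "nat \<Rightarrow> (int \<Rightarrow> int \<Rightarrow> real) \<Rightarrow> (plane \<Rightarrow> real) \<Rightarrow> real \<Rightarrow> bool" where
  "approximates d Y F \<delta> \<longleftrightarrow> 1 \<le> d \<and> 0 \<le> \<delta> \<and> box_supported d Y \<and>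
     (\<forall>z. \<bar>grid d Y z - F z\<bar> \<le> \<delta> * indicator unit_square z)"

definition sqnorm :: "nat \<Rightarrow> (int \<Rightarrow> int \<Rightarrow> real) \<Rightarrow> real" where
  "sqnorm d Y = box_sum d (\<lambda>i j. (Y i j)\<^sup>2)"

definition cosine :: "nat \<Rightarrow> (int \<Rightarrow> int \<Rightarrow> real) \<Rightarrow> (int \<Rightarrow> int \<Rightarrow> real) \<Rightarrow> int \<Rightarrow> int \<Rightarrow> real" where
  "cosine d Y X s s' = corr d Y X s s' / (sqrt (sqnorm d Y) * sqrt (sqnorm d X))"

lemma sqnorm_nonneg: "0 \<le> sqnorm d Y"
  unfolding sqnorm_def box_sum_def by (auto intro!: sum_nonneg)

lemma integral_indicator_unit_square_shift:
  fixes c :: plane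
  shows "has_bochner_integral lborel (\<lambda>z. indicator unit_square (z + c) :: real) 1"
proof -
  obtain c1 c2 where c: "c = (c1, c2)" by (cases c)
  have "(\<lambda>z. indicator unit_square (z + c) :: real) = indicator ({- c1..1 - c1} \<times> {- c2..1 - c2})"
    unfolding c by (rule ext) (auto simp: indicator_def)
  moreover have "has_bochner_integral lborel (indicator ({- c1..1 - c1} \<times> {- c2..1 - c2}) :: plane \<Rightarrow> real) 1"
    using has_integral_indicator_rectangle(2)[of "- c1" "1 - c1" "- c2" "1 - c2"] by simp
  ultimately show ?thesis by simp
qed

lemma square_le_three:
  fixes u x y z :: real
  assumes "\<bar>u\<bar> \<le> \<bar>x\<bar> + \<bar>y\<bar> + \<bar>z\<bar>"
  shows "u\<^sup>2 \<le> 3 * x\<^sup>2 + 3 * y\<^sup>2 + 3 * z\<^sup>2"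
proof -
  have "u\<^sup>2 \<le> (\<bar>x\<bar> + \<bar>y\<bar> + \<bar>z\<bar>)\<^sup>2"
    using assms by (metis abs_ge_zero power2_abs power_mono)
  also have "\<dots> \<le> 3 * \<bar>x\<bar>\<^sup>2 + 3 * \<bar>y\<bar>\<^sup>2 + 3 * \<bar>z\<bar>\<^sup>2"
    using zero_le_power2[of "\<bar>x\<bar> - \<bar>y\<bar>"] zero_le_power2[of "\<bar>y\<bar> - \<bar>z\<bar>"] zero_le_power2[of "\<bar>x\<bar> - \<bar>z\<bar>"]
    by (simp add: power2_sum power2_diff power2_eq_square algebra_simps)
  finally show ?thesis by simp
qed

lemma has_integral_indicator_square:
  fixes c :: plane and \<delta> :: real
  shows "has_bochner_integral lborel (\<lambda>z. (\<delta> * indicator unit_square (z + c))\<^sup>2) (\<delta>\<^sup>2)"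
proof -
  have "(\<lambda>z. (\<delta> * indicator unit_square (z + c))\<^sup>2) = (\<lambda>z. \<delta>\<^sup>2 * indicator unit_square (z + c))"
    by (auto simp: power_mult_distrib indicator_def fun_eq_iff)
  then show ?thesis
    using has_bochner_integral_mult_right[OF integral_indicator_unit_square_shift[of c], of "\<delta>\<^sup>2"] by simp
qed

text \<open>A triangle inequality with squares, at the price of the factor 3. If the square of
  \<open>f\<close> is not integrable, its integral is 0 by convention and still lies below the
  nonnegative majorant.\<close>

lemma integral_square_le_three:
  fixes f g1 g2 g3 :: "plane \<Rightarrow> real"
  assumes "has_bochner_integral lborel (\<lambda>z. (g1 z)\<^sup>2) i1" "has_bochner_integral lborel (\<lambda>z. (g2 z)\<^sup>2) i2"
    "has_bochner_integral lborel (\<lambda>z. (g3 z)\<^sup>2) i3"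
    and le: "\<And>z. \<bar>f z\<bar> \<le> \<bar>g1 z\<bar> + \<bar>g2 z\<bar> + \<bar>g3 z\<bar>"
  shows "(LINT z|lborel. (f z)\<^sup>2) \<le> 3 * i1 + 3 * i2 + 3 * i3"
proof -
  have *: "has_bochner_integral lborel (\<lambda>z. 3 * (g1 z)\<^sup>2 + 3 * (g2 z)\<^sup>2 + 3 * (g3 z)\<^sup>2) (3 * i1 + 3 * i2 + 3 * i3)"
    by (intro has_bochner_integral_add has_bochner_integral_mult_right assms)
  have "(LINT z|lborel. (f z)\<^sup>2) \<le> (LINT z|lborel. 3 * (g1 z)\<^sup>2 + 3 * (g2 z)\<^sup>2 + 3 * (g3 z)\<^sup>2)"
    using * le by (intro integral_mono' square_le_three) (auto simp: has_bochner_integral_iff)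
  with * show ?thesis by (simp add: has_bochner_integral_iff)
qed

text \<open>The difference of the functions splits into the difference of their grid functions and
  two errors, one on a translated square and scaled by \<open>a\<close>, the other on the unit
  square.\<close>

lemma integral_diff_le_grid:
  fixes s s' :: int and a :: real
  assumes Y: "approximates d Y F \<delta>F" and X: "approximates d X G \<delta>G"
  shows "(LINT z|lborel. (a * F (z + (of_int s / real d, of_int s' / real d)) - G z)\<^sup>2)
     \<le> 3 * ((a\<^sup>2 * sqnorm d Y - 2 * a * corr d Y X s s' + sqnorm d X) / (real d)\<^sup>2) + 3 * (a * \<delta>F)\<^sup>2 + 3 * \<delta>G\<^sup>2"
proof -
  let ?c = "(of_int s / real d, of_int s' / real d)"
  have d: "d \<ge> 1" using Y by (simp add: approximates_def)
  show ?thesis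
  proof (rule integral_square_le_three)
    show "has_bochner_integral lborel (\<lambda>z. (a * grid d Y (z + ?c) - grid d X z)\<^sup>2)
       ((a\<^sup>2 * sqnorm d Y - 2 * a * corr d Y X s s' + sqnorm d X) / (real d)\<^sup>2)"
      unfolding sqnorm_def using X Y d
      by (intro has_integral_grid_diff_square) (auto simp: approximates_def)
    show "has_bochner_integral lborel (\<lambda>z. (a * \<delta>F * indicator unit_square (z + ?c))\<^sup>2) ((a * \<delta>F)\<^sup>2)"
      by (rule has_integral_indicator_square)
    show "has_bochner_integral lborel (\<lambda>z. (\<delta>G * indicator unit_square (z + 0))\<^sup>2) (\<delta>G\<^sup>2)"
      by (rule has_integral_indicator_square)
    show "\<bar>a * F (z + ?c) - G z\<bar> \<le> \<bar>a * grid d Y (z + ?c) - grid d X z\<bar>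
        + \<bar>a * \<delta>F * indicator unit_square (z + ?c)\<bar> + \<bar>\<delta>G * indicator unit_square (z + 0)\<bar>" for z
    proof -
      have "\<bar>grid d Y (z + ?c) - F (z + ?c)\<bar> \<le> \<delta>F * indicator unit_square (z + ?c)"
        using Y unfolding approximates_def by blast
      then have "\<bar>a\<bar> * \<bar>grid d Y (z + ?c) - F (z + ?c)\<bar> \<le> \<bar>a\<bar> * (\<delta>F * indicator unit_square (z + ?c))"
        by (intro mult_left_mono) auto
      then have "\<bar>a * grid d Y (z + ?c) - a * F (z + ?c)\<bar> \<le> \<bar>a * \<delta>F * indicator unit_square (z + ?c)\<bar>"
        using Y by (simp add: approximates_def abs_mult right_diff_distrib[symmetric] mult.assoc)
      moreover have "\<bar>grid d X z - G z\<bar> \<le> \<delta>G * indicator unit_square z"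
        using X unfolding approximates_def by blast
      then have "\<bar>grid d X z - G z\<bar> \<le> \<bar>\<delta>G * indicator unit_square (z + 0)\<bar>"
        by simp
      ultimately show ?thesis by linarith
    qed
  qed
qed

text \<open>The splitting is now used in reverse: the grid functions differ by two discretisation
  errors and the gap between \<open>F\<close> and \<open>G\<close>, whence 9 = 3 + 3 + 3.\<close>

lemma grid_diff_le:
  fixes s s' :: int
  assumes Y: "approximates d Y F \<delta>" and X: "approximates d X G \<delta>"
    and FG: "\<And>z. \<bar>F (z + (of_int s / real d, of_int s' / real d)) - G z\<bar> \<le> \<delta> * indicator unit_square z"
  shows "sqnorm d Y - 2 * corr d Y X s s' + sqnorm d X \<le> 9 * \<delta>\<^sup>2 * (real d)\<^sup>2"
proof -
  let ?c = "(of_int s / real d, of_int s' / real d)"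
  have d: "d \<ge> 1" using Y by (simp add: approximates_def)
  have "(LINT z|lborel. (grid d Y (z + ?c) - grid d X z)\<^sup>2) \<le> 3 * \<delta>\<^sup>2 + 3 * \<delta>\<^sup>2 + 3 * \<delta>\<^sup>2"
  proof (rule integral_square_le_three)
    show "has_bochner_integral lborel (\<lambda>z. (\<delta> * indicator unit_square (z + ?c))\<^sup>2) (\<delta>\<^sup>2)"
      by (rule has_integral_indicator_square)
    show 0: "has_bochner_integral lborel (\<lambda>z. (\<delta> * indicator unit_square (z + 0))\<^sup>2) (\<delta>\<^sup>2)"
      by (rule has_integral_indicator_square)
    show "has_bochner_integral lborel (\<lambda>z. (\<delta> * indicator unit_square (z + 0))\<^sup>2) (\<delta>\<^sup>2)"
      by (fact 0)
    show "\<bar>grid d Y (z + ?c) - grid d X z\<bar> \<le> \<bar>\<delta> * indicator unit_square (z + ?c)\<bar>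
        + \<bar>\<delta> * indicator unit_square (z + 0)\<bar> + \<bar>\<delta> * indicator unit_square (z + 0)\<bar>" for z
    proof -
      have "\<bar>grid d Y (z + ?c) - F (z + ?c)\<bar> \<le> \<delta> * indicator unit_square (z + ?c)"
        using Y unfolding approximates_def by blast
      moreover have "\<bar>grid d X z - G z\<bar> \<le> \<delta> * indicator unit_square z"
        using X unfolding approximates_def by blast
      ultimately show ?thesis using FG[of z] by simp
    qed
  qed
  moreover have "has_bochner_integral lborel (\<lambda>z. (1 * grid d Y (z + ?c) - grid d X z)\<^sup>2)
       ((1\<^sup>2 * sqnorm d Y - 2 * 1 * corr d Y X s s' + sqnorm d X) / (real d)\<^sup>2)"
    unfolding sqnorm_def using X Y d
    by (intro has_integral_grid_diff_square) (auto simp: approximates_def)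
  ultimately have "(sqnorm d Y - 2 * corr d Y X s s' + sqnorm d X) / (real d)\<^sup>2 \<le> 9 * \<delta>\<^sup>2"
    by (simp add: has_bochner_integral_iff)
  then show ?thesis
    using d by (simp add: field_simps)
qed

text \<open>For norms y and x that need not agree, 2 y x <= y^2 + x^2 replaces the identity for unit
  vectors: 2 (y x - \<open>corr\<close>) is at most the squared distance, and y x is at least m
  d^2.\<close>

lemma cosine_ge:
  fixes s s' :: int
  assumes "approximates d Y F \<delta>" "approximates d X G \<delta>"
    and "\<And>z. \<bar>F (z + (of_int s / real d, of_int s' / real d)) - G z\<bar> \<le> \<delta> * indicator unit_square z"
    and m: "0 < m" "m * (real d)\<^sup>2 \<le> sqnorm d Y" "m * (real d)\<^sup>2 \<le> sqnorm d X"
  shows "1 - 9 * \<delta>\<^sup>2 / (2 * m) \<le> cosine d Y X s s'"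
proof -
  define y x where "y = sqrt (sqnorm d Y)" and "x = sqrt (sqnorm d X)"
  have d: "d \<ge> 1" using assms by (simp add: approximates_def)
  then have md: "0 < m * (real d)\<^sup>2" using m by simp
  have sq: "y\<^sup>2 = sqnorm d Y" "x\<^sup>2 = sqnorm d X"
    by (simp_all add: x_def y_def sqnorm_nonneg)
  have "sqrt (m * (real d)\<^sup>2) \<le> y" "sqrt (m * (real d)\<^sup>2) \<le> x"
    unfolding x_def y_def using m by simp_all
  then have xy: "m * (real d)\<^sup>2 \<le> y * x"
    using mult_mono[of "sqrt (m * (real d)\<^sup>2)" y "sqrt (m * (real d)\<^sup>2)" x] md
    by (smt (verit) real_sqrt_ge_zero real_sqrt_mult_self abs_of_nonneg)
  have "2 * (y * x) - 2 * corr d Y X s s' \<le> 9 * \<delta>\<^sup>2 * (real d)\<^sup>2"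
    using grid_diff_le[OF assms(1-3)] sum_squares_bound[of y x] sq by simp
  moreover have nz: "y \<noteq> 0" "x \<noteq> 0" "0 \<le> y" "0 \<le> x"
    using xy md by (auto simp: x_def y_def sqnorm_nonneg)
  ultimately have "1 - corr d Y X s s' / (y * x) \<le> 9 * \<delta>\<^sup>2 * (real d)\<^sup>2 / (2 * (y * x))"
    using nz divide_right_mono[of "2 * (y * x) - 2 * corr d Y X s s'" "9 * \<delta>\<^sup>2 * (real d)\<^sup>2" "2 * (y * x)"]
    by (simp add: diff_divide_distrib)
  also have "\<dots> \<le> 9 * \<delta>\<^sup>2 * (real d)\<^sup>2 / (2 * (m * (real d)\<^sup>2))"
    using xy md by (intro frac_le) auto
  also have "\<dots> = 9 * \<delta>\<^sup>2 / (2 * m)"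
    using d by simp
  finally show ?thesis
    by (simp add: cosine_def x_def y_def)
qed

text \<open>The scalar \<open>a\<close> is the one for which \<open>a Y\<close>, shifted, is the projection of \<open>X\<close>.\<close>

lemma separated_imp_cosine:
  fixes s s' :: int
  assumes Y: "approximates d Y F \<delta>F" and X: "approximates d X G \<delta>G"
    and E: "\<And>a. E \<le> (LINT z|lborel. (a * F (z + (of_int s / real d, of_int s' / real d)) - G z)\<^sup>2)"
    and pos: "0 < sqnorm d Y" "0 < sqnorm d X"
  shows "E \<le> 3 * (sqnorm d X / (real d)\<^sup>2) * (1 - (cosine d Y X s s')\<^sup>2)
     + 3 * (cosine d Y X s s')\<^sup>2 * (sqnorm d X / sqnorm d Y) * \<delta>F\<^sup>2 + 3 * \<delta>G\<^sup>2"
proof -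
  define y x where "y = sqrt (sqnorm d Y)" and "x = sqrt (sqnorm d X)"
  define \<rho> where "\<rho> = cosine d Y X s s'"
  define a where "a = \<rho> * x / y"
  have p: "0 < y" "0 < x" using pos by (simp_all add: x_def y_def)
  have sq: "y\<^sup>2 = sqnorm d Y" "x\<^sup>2 = sqnorm d X"
    by (simp_all add: x_def y_def sqnorm_nonneg)
  have c: "corr d Y X s s' = \<rho> * (y * x)"
    using p by (simp add: \<rho>_def cosine_def x_def y_def)
  have "a\<^sup>2 * sqnorm d Y - 2 * a * corr d Y X s s' + sqnorm d X = sqnorm d X * (1 - \<rho>\<^sup>2)"
    unfolding c sq[symmetric] a_def using p by (simp add: power2_eq_square field_simps)
  moreover have "(a * \<delta>F)\<^sup>2 = \<rho>\<^sup>2 * (sqnorm d X / sqnorm d Y) * \<delta>F\<^sup>2"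
    unfolding sq[symmetric] a_def by (simp add: power_mult_distrib power_divide)
  ultimately show ?thesis
    using order_trans[OF E[of a] integral_diff_le_grid[OF Y X, of a s s']]
    by (simp add: \<rho>_def)
qed

lemma cosine_commute:
  assumes "box_supported d Y" "box_supported d X"
  shows "cosine d X Y (- s) (- s') = cosine d Y X s s'"
  by (simp add: cosine_def corr_commute[OF assms] mult.commute)

lemma sqnorm_le:
  assumes X: "approximates d X G \<delta>" and G: "\<And>z. \<bar>G z\<bar> \<le> b * indicator unit_square z" and b: "0 \<le> b"
  shows "sqnorm d X / (real d)\<^sup>2 \<le> (b + \<delta>)\<^sup>2"
proof -
  have d: "d \<ge> 1" and sX: "box_supported d X" using X by (auto simp: approximates_def)
  have "has_bochner_integral lborel (\<lambda>z. (grid d X (z + 0))\<^sup>2) (sqnorm d X / (real d)\<^sup>2)"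
    using has_integral_grid[OF d, of "\<lambda>i j. (X i j)\<^sup>2" 0] sX by (simp add: sqnorm_def grid_def box_supported_def)
  moreover have "(LINT z|lborel. (grid d X (z + 0))\<^sup>2) \<le> (LINT z|lborel. ((b + \<delta>) * indicator unit_square (z + 0))\<^sup>2)"
  proof (rule integral_mono')
    show "integrable lborel (\<lambda>z. ((b + \<delta>) * indicator unit_square (z + 0))\<^sup>2)"
      using has_integral_indicator_square[of "b + \<delta>" 0] by (simp add: has_bochner_integral_iff)
    show "(grid d X (z + 0))\<^sup>2 \<le> ((b + \<delta>) * indicator unit_square (z + 0))\<^sup>2" for z
    proof (rule abs_le_square_iff[THEN iffD1])
      have "\<bar>grid d X z - G z\<bar> \<le> \<delta> * indicator unit_square z"
        using X unfolding approximates_def by blast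
      then show "\<bar>grid d X (z + 0)\<bar> \<le> \<bar>(b + \<delta>) * indicator unit_square (z + 0)\<bar>"
        using G[of z] by (simp add: distrib_right)
    qed
  qed auto
  ultimately show ?thesis
    using has_integral_indicator_square[of "b + \<delta>" 0] by (simp add: has_bochner_integral_iff)
qed

lemma sqnorm_ge:
  assumes X: "approximates d X G \<delta>"
  shows "(LINT z|lborel. (G z)\<^sup>2) \<le> 3 * (sqnorm d X / (real d)\<^sup>2) + 3 * \<delta>\<^sup>2"
  \<comment> \<open>With scalar 0 the translated function disappears and \<open>G\<close> is
    compared with its grid function alone.\<close>
  using integral_diff_le_grid[OF X X, of 0 0 0] by simp

section \<open>Lipschitz functions supported in the unit square and their discretisation\<close>

definition lipschitz_taxi :: "real \<Rightarrow> (plane \<Rightarrow> real) \<Rightarrow> bool" where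
  "lipschitz_taxi \<Lambda> F \<longleftrightarrow> 0 \<le> \<Lambda> \<and>
     (\<forall>z z'. \<bar>F z - F z'\<bar> \<le> \<Lambda> * (\<bar>fst z - fst z'\<bar> + \<bar>snd z - snd z'\<bar>))"

lemma lipschitz_taxiD:
  "lipschitz_taxi \<Lambda> F \<Longrightarrow> \<bar>F z - F z'\<bar> \<le> \<Lambda> * (\<bar>fst z - fst z'\<bar> + \<bar>snd z - snd z'\<bar>)"
  unfolding lipschitz_taxi_def by blast

lemma lipschitz_taxi_continuous:
  assumes "lipschitz_taxi \<Lambda> F"
  shows "continuous_on UNIV F"
proof -
  have "dist (F z) (F z') \<le> (2 * \<Lambda>) * dist z z'" for z z'
  proof -
    have "dist (F z) (F z') \<le> \<Lambda> * (\<bar>fst z - fst z'\<bar> + \<bar>snd z - snd z'\<bar>)"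
      using lipschitz_taxiD[OF assms] by (simp add: dist_real_def)
    also have "\<dots> \<le> \<Lambda> * (2 * dist z z')"
      using dist_fst_le[of z z'] dist_snd_le[of z z'] assms
      by (intro mult_left_mono) (auto simp: dist_real_def lipschitz_taxi_def)
    finally show ?thesis by (simp add: mult_ac)
  qed
  then have "(2 * \<Lambda>)-lipschitz_on UNIV F"
    using assms by (intro lipschitz_onI) (auto simp: lipschitz_taxi_def)
  then show ?thesis by (rule lipschitz_on_continuous_on)
qed

lemma lipschitz_taxi_bound:
  assumes F: "lipschitz_taxi \<Lambda> F" and supp: "supp F \<subseteq> unit_square"
  shows "\<bar>F z\<bar> \<le> (2 * \<Lambda>) * indicator unit_square z"
proof (cases "z \<in> unit_square")
  case True
  \<comment> \<open>This point lies outside the unit square, at horizontal distance at most 2 from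
    \<open>z\<close>.\<close>
  have "F (2, snd z) = 0" using supp by (force simp: supp_def)
  then have "\<bar>F z\<bar> \<le> \<Lambda> * \<bar>fst z - 2\<bar>"
    using lipschitz_taxiD[OF F, of z "(2, snd z)"] by simp
  also have "\<dots> \<le> \<Lambda> * 2"
    using True F by (intro mult_left_mono) (auto simp: lipschitz_taxi_def)
  finally show ?thesis using True by simp
next
  case False
  then have "F z = 0" using supp by (auto simp: supp_def)
  with False show ?thesis by simp
qed

lemma lipschitz_taxi_integrable:
  assumes F: "lipschitz_taxi \<Lambda> F" and supp: "supp F \<subseteq> unit_square"
  shows "integrable lborel F" and "integrable lborel (\<lambda>z. (F z)\<^sup>2)"
proof -
  have m: "F \<in> borel_measurable borel"
    using lipschitz_taxi_continuous[OF F] by (rule borel_measurable_continuous_onI)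
  have i: "integrable lborel (\<lambda>z. b * indicator unit_square z :: real)" for b
    using integral_indicator_unit_square_shift[of 0] by (simp add: has_bochner_integral_iff)
  have "norm (F z) \<le> norm (2 * \<Lambda> * indicator unit_square z)" for z
    unfolding real_norm_def by (rule order_trans[OF lipschitz_taxi_bound[OF assms] abs_ge_self])
  with m show "integrable lborel F"
    by (intro Bochner_Integration.integrable_bound[OF i[of "2 * \<Lambda>"]]) simp_all
  show "integrable lborel (\<lambda>z. (F z)\<^sup>2)"
  proof (rule Bochner_Integration.integrable_bound[OF i[of "(2 * \<Lambda>)\<^sup>2"]])
    have "(F z)\<^sup>2 \<le> ((2 * \<Lambda>) * indicator unit_square z)\<^sup>2" for z
      using lipschitz_taxi_bound[OF assms, of z] by (metis abs_ge_zero power2_abs power_mono)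
    moreover have "((2 * \<Lambda>) * indicator unit_square z)\<^sup>2 = (2 * \<Lambda>)\<^sup>2 * (indicator unit_square z :: real)" for z
      by (simp add: indicator_def)
    ultimately show "AE z in lborel. norm ((F z)\<^sup>2) \<le> norm ((2 * \<Lambda>)\<^sup>2 * indicator unit_square z :: real)"
      by (simp add: abs_mult)
  qed (use m in measurable)
qed

text \<open>On the square of half-width \<open>r\<close> around \<open>z0\<close> the function drops
  by at most 2 \<Lambda> r <= v/2, so it stays above v/2 on an area of 4 r^2.\<close>

lemma integral_square_ge:
  assumes F: "lipschitz_taxi \<Lambda> F" and supp: "supp F \<subseteq> unit_square"
    and v: "0 \<le> v" "v \<le> F z0" and r: "0 \<le> r" "4 * \<Lambda> * r \<le> v"
  shows "v\<^sup>2 * r\<^sup>2 \<le> (LINT z|lborel. (F z)\<^sup>2)"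
proof -
  let ?B = "{fst z0 - r..fst z0 + r} \<times> {snd z0 - r..snd z0 + r}"
  have B: "has_bochner_integral lborel (\<lambda>z. (v / 2)\<^sup>2 * indicator ?B z) ((v / 2)\<^sup>2 * ((2 * r) * (2 * r)))"
    using has_integral_indicator_rectangle(2)[of "fst z0 - r" "fst z0 + r" "snd z0 - r" "snd z0 + r"] r
    by (intro has_bochner_integral_mult_right) simp
  have "v\<^sup>2 * r\<^sup>2 = (v / 2)\<^sup>2 * ((2 * r) * (2 * r))"
    by (simp add: power2_eq_square)
  also have "\<dots> = (LINT z|lborel. (v / 2)\<^sup>2 * indicator ?B z)"
    using B by (simp only: has_bochner_integral_iff)
  also have "\<dots> \<le> (LINT z|lborel. (F z)\<^sup>2)"
  proof (rule integral_mono)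
    show "integrable lborel (\<lambda>z. (v / 2)\<^sup>2 * indicator ?B z)"
      using B by (simp only: has_bochner_integral_iff)
    show "(v / 2)\<^sup>2 * indicator ?B z \<le> (F z)\<^sup>2" for z
    proof (cases "z \<in> ?B")
      case True
      have "\<bar>F z - F z0\<bar> \<le> \<Lambda> * (r + r)"
        using True F by (intro order_trans[OF lipschitz_taxiD[OF F]] mult_left_mono)
          (auto simp: lipschitz_taxi_def mem_Times_iff)
      then have "v / 2 \<le> F z"
        using v r by (simp add: distrib_left)
      then show ?thesis
        using True v by (simp del: power_divide)
    qed simp
  qed (rule lipschitz_taxi_integrable[OF F supp])
  finally show ?thesis .
qed

text \<open>The bound \<Lambda>/d serves the right and upper edges of the unit square: half-open
  pixels in the box leave them uncovered, so the grid function is 0 there, while \<open>F\<close>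
  vanishes one pixel width further out.\<close>

lemma approximatesI:
  assumes d: "1 \<le> d" and Y: "box_supported d Y" and F: "lipschitz_taxi \<Lambda> F"
    and supp: "supp F \<subseteq> unit_square" and \<delta>: "\<Lambda> / real d \<le> \<delta>"
    and close: "\<And>i j z. (i, j) \<in> {1..int d} \<times> {1..int d} \<Longrightarrow>
      fst z \<in> {(of_int i - 1) / real d..<of_int i / real d} \<Longrightarrow>
      snd z \<in> {(of_int j - 1) / real d..<of_int j / real d} \<Longrightarrow> \<bar>Y i j - F z\<bar> \<le> \<delta>"
  shows "approximates d Y F \<delta>"
proof -
  have \<delta>0: "0 \<le> \<delta>"
    using F d \<delta> by (intro order_trans[OF _ \<delta>]) (simp add: lipschitz_taxi_def)
  have "\<bar>grid d Y z - F z\<bar> \<le> \<delta> * indicator unit_square z" for z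
  proof -
    define i j where "i = \<lfloor>real d * fst z\<rfloor> + 1" and "j = \<lfloor>real d * snd z\<rfloor> + 1"
    have ij: "fst z \<in> {(of_int i - 1) / real d..<of_int i / real d}"
      "snd z \<in> {(of_int j - 1) / real d..<of_int j / real d}"
      using floor_pixel_iff[OF d] i_def j_def by blast+
    have range: "1 \<le> \<lfloor>real d * x\<rfloor> + 1 \<and> \<lfloor>real d * x\<rfloor> + 1 \<le> int d \<longleftrightarrow> 0 \<le> x \<and> x < 1" for x
    proof -
      have "\<lfloor>real d * x\<rfloor> + 1 \<le> int d \<longleftrightarrow> real d * x < real d * 1"
        by linarith
      then show ?thesis using d by (simp add: zero_le_mult_iff del: mult_1_right)
    qed
    show ?thesis
    proof (cases "(i, j) \<in> {1..int d} \<times> {1..int d}")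
      case True
      then have "z \<in> unit_square"
        using range[of "fst z"] range[of "snd z"] by (auto simp: i_def j_def mem_Times_iff)
      then show ?thesis
        using close[OF True ij] by (simp add: grid_def i_def j_def)
    next
      case out: False
      then have g0: "grid d Y z = 0"
        using Y by (simp add: grid_def box_supported_def i_def j_def)
      show ?thesis
      proof (cases "z \<in> unit_square")
        case True
        have "fst z = 1 \<or> snd z = 1"
          using out True range[of "fst z"] range[of "snd z"] by (auto simp: i_def j_def mem_Times_iff)
        moreover have "F w = 0" if "w \<notin> unit_square" for w
          using supp that by (auto simp: supp_def)
        ultimately have "F (fst z + 1 / real d, snd z) = 0 \<or> F (fst z, snd z + 1 / real d) = 0"
          using d by (auto simp: mem_Times_iff)
        then have "\<bar>F z\<bar> \<le> \<Lambda> / real d"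
          using lipschitz_taxiD[OF F, of z "(fst z + 1 / real d, snd z)"]
            lipschitz_taxiD[OF F, of z "(fst z, snd z + 1 / real d)"] by auto
        with True \<delta> g0 show ?thesis by simp
      next
        case False
        then have "F z = 0" using supp by (auto simp: supp_def)
        with False g0 show ?thesis by simp
      qed
    qed
  qed
  with d \<delta>0 Y show ?thesis by (simp add: approximates_def)
qed

text \<open>Since d^2 is the reciprocal of the pixel area, for brightness 1 an entry is the mean of
  the deformed template over its pixel. That mean lies between any value in the pixel minus and plus
  the oscillation 2 \<Lambda>/d.\<close>

lemma approximates_image:
  assumes d: "1 \<le> d" and F: "lipschitz_taxi \<Lambda> (f \<circ> A)" and supp: "supp (f \<circ> A) \<subseteq> unit_square"
    and \<delta>: "2 * \<Lambda> / real d \<le> \<delta>"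
  shows "approximates d (zext d (image_of d f A 1)) (f \<circ> A) \<delta>"
proof (rule approximatesI[OF d box_supported_zext F supp])
  have \<Lambda>: "0 \<le> \<Lambda>" using F by (simp add: lipschitz_taxi_def)
  then have "\<Lambda> / real d \<le> 2 * \<Lambda> / real d" by (intro divide_right_mono) auto
  with \<delta> show "\<Lambda> / real d \<le> \<delta>" by simp
  fix i j :: int and z :: plane
  assume ij: "(i, j) \<in> {1..int d} \<times> {1..int d}"
    and z: "fst z \<in> {(of_int i - 1) / real d..<of_int i / real d}"
      "snd z \<in> {(of_int j - 1) / real d..<of_int j / real d}"
  define P where "P = {(of_int i - 1) / real d..<of_int i / real d} \<times> {(of_int j - 1) / real d..<of_int j / real d}"
  have le: "(of_int i - 1) / real d \<le> of_int i / real d" for i by (simp add: divide_right_mono)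
  have df: "of_int i / real d - (of_int i - 1) / real d = 1 / real d" for i by (simp add: diff_divide_distrib)
  have P: "has_bochner_integral lborel (indicator P :: plane \<Rightarrow> real) (1 / (real d)\<^sup>2)"
    using has_integral_indicator_rectangle(1)[OF le[of i] le[of j]] by (simp add: P_def df power2_eq_square)
  have "P \<in> sets lborel" by (auto simp: P_def borel_prod[symmetric])
  then have int: "integrable lborel (\<lambda>z. indicator P z * (f \<circ> A) z)"
    using integrable_mult_indicator[OF _ lipschitz_taxi_integrable(1)[OF F supp]] by simp
  have close: "\<bar>(f \<circ> A) z' - (f \<circ> A) z\<bar> \<le> \<delta>" if "z' \<in> P" for z'
  proof -
    have "\<bar>x' - x\<bar> \<le> 1 / real d" if "x \<in> {(of_int i - 1) / real d..<of_int i / real d}"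
      "x' \<in> {(of_int i - 1) / real d..<of_int i / real d}" for x x' i
      using that df[of i] by (simp add: abs_le_iff)
    then have "\<bar>fst z' - fst z\<bar> \<le> 1 / real d \<and> \<bar>snd z' - snd z\<bar> \<le> 1 / real d"
      using that z by (auto simp: P_def mem_Times_iff)
    then have "\<bar>(f \<circ> A) z' - (f \<circ> A) z\<bar> \<le> \<Lambda> * (1 / real d + 1 / real d)"
      using \<Lambda> by (intro order_trans[OF lipschitz_taxiD[OF F]] mult_left_mono) auto
    also have "\<dots> \<le> \<delta>" using \<delta> by (simp add: mult.commute)
    finally show ?thesis .
  qed
  have I: "integrable lborel (\<lambda>z. c * indicator P z)" "(LINT z|lborel. c * indicator P z) = c / (real d)\<^sup>2" for c :: real
    using P by (auto simp: has_bochner_integral_iff)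
  have "(LINT z'|lborel. ((f \<circ> A) z - \<delta>) * indicator P z') \<le> (LINT z'|lborel. indicator P z' * (f \<circ> A) z')"
    using close by (intro integral_mono int I) (auto simp: indicator_def abs_le_iff algebra_simps)
  moreover have "(LINT z'|lborel. indicator P z' * (f \<circ> A) z') \<le> (LINT z'|lborel. ((f \<circ> A) z + \<delta>) * indicator P z')"
    using close by (intro integral_mono int I) (auto simp: indicator_def abs_le_iff algebra_simps)
  moreover have "zext d (image_of d f A 1) i j = (real d)\<^sup>2 * (LINT z'|lborel. indicator P z' * (f \<circ> A) z')"
    using ij by (simp add: zext_def image_of_def pixel_def P_def set_lebesgue_integral_def)
  ultimately show "\<bar>zext d (image_of d f A 1) i j - (f \<circ> A) z\<bar> \<le> \<delta>"
    using d unfolding I by (simp add: abs_le_iff field_simps)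
qed

section \<open>Filters that are constant on blocks\<close>

definition block_length :: "real \<Rightarrow> nat \<Rightarrow> nat" where
  "block_length \<alpha> d = nat \<lfloor>real d powr (1 - \<alpha>) + 1\<rfloor>"

text \<open>The lower coordinate of the block containing pixel \<open>j\<close>; the shift by 1
  turns one-based pixel indices into zero-based multiples of the block length. Sampling there makes
  a filter constant on blocks.\<close>

definition block_corner :: "real \<Rightarrow> nat \<Rightarrow> nat \<Rightarrow> real" where
  "block_corner \<alpha> d j = real (block_length \<alpha> d * ((j - 1) div block_length \<alpha> d)) / real d"

definition block_sample :: "real \<Rightarrow> nat \<Rightarrow> (plane \<Rightarrow> real) \<Rightarrow> matr" where
  "block_sample \<alpha> d F = (\<lambda>j l. F (block_corner \<alpha> d j, block_corner \<alpha> d l))"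

lemma block_length_pos: "1 \<le> block_length \<alpha> d"
proof -
  have "0 \<le> real d powr (1 - \<alpha>)" by simp
  then have "1 \<le> \<lfloor>real d powr (1 - \<alpha>) + 1\<rfloor>" by linarith
  then show ?thesis unfolding block_length_def by linarith
qed

lemma block_length_le:
  assumes "1 \<le> d" "0 < \<alpha>" "\<alpha> \<le> 1"
  shows "real (block_length \<alpha> d) / real d \<le> 2 * real d powr (- \<alpha>)"
proof -
  have "real (block_length \<alpha> d) \<le> real d powr (1 - \<alpha>) + 1"
    unfolding block_length_def using of_int_floor_le[of "real d powr (1 - \<alpha>) + 1"]
    by (simp add: of_nat_nat)
  \<comment> \<open>As \<alpha> <= 1, the power is at least 1, so the extra 1 in the block length
    costs at most a factor 2.\<close>
  also have "\<dots> \<le> 2 * real d powr (1 - \<alpha>)"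
    using ge_one_powr_ge_zero[of "real d" "1 - \<alpha>"] assms by simp
  also have "real d powr (1 - \<alpha>) = real d * real d powr (- \<alpha>)"
    using assms by (simp add: powr_diff powr_minus field_simps)
  finally show ?thesis using assms by (simp add: field_simps)
qed

lemma block_corner_eq:
  assumes "j \<in> block \<alpha> d i" "i \<ge> 1"
  shows "block_corner \<alpha> d j = real (block_length \<alpha> d * (i - 1)) / real d"
proof -
  let ?b = "block_length \<alpha> d"
  have "?b * (i - 1) \<le> j - 1" "j - 1 < ?b * (i - 1) + ?b"
    using assms block_length_pos[of \<alpha> d] unfolding block_def Let_def block_length_def[symmetric]
    by (auto simp: algebra_simps diff_mult_distrib2)
  then have "(j - 1) div ?b = i - 1"
    by (metis add.commute div_nat_eqI mult.commute mult_Suc_right)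
  then show ?thesis by (simp add: block_corner_def)
qed

lemma block_corner_near:
  assumes d: "1 \<le> d" and i: "i \<in> {1..int d}" and x: "x \<in> {(of_int i - 1) / real d..<of_int i / real d}"
  shows "\<bar>block_corner \<alpha> d (nat i) - x\<bar> \<le> real (block_length \<alpha> d) / real d"
proof -
  let ?b = "block_length \<alpha> d" and ?j = "nat i - 1"
  have b: "1 \<le> ?b" by (rule block_length_pos)
  have 1: "?b * (?j div ?b) \<le> ?j" by simp
  have "?j mod ?b < ?b" using b by simp
  then have 2: "?j + 1 \<le> ?b * (?j div ?b) + ?b"
    using mult_div_mod_eq[of ?b ?j] by linarith
  have "int ?j = i - 1" using i by auto
  then have j: "real ?j = of_int i - 1" by (metis of_int_1 of_int_diff of_int_of_nat_eq)
  have "real (?b * (?j div ?b)) \<le> real ?j" using 1 by (simp only: of_nat_le_iff)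
  then have "block_corner \<alpha> d (nat i) \<le> (of_int i - 1) / real d"
    unfolding block_corner_def j[symmetric] by (intro divide_right_mono) auto
  moreover have "real ?j + 1 \<le> real (?b * (?j div ?b)) + real ?b" using 2 by linarith
  then have "of_int i / real d \<le> block_corner \<alpha> d (nat i) + real ?b / real d"
    unfolding block_corner_def add_divide_distrib[symmetric] using j by (intro divide_right_mono) auto
  ultimately show ?thesis using x by (simp add: abs_le_iff)
qed

lemma block_structure_sample: "block_structure \<alpha> d (block_sample \<alpha> d F)"
  unfolding block_structure_def block_sample_def by (auto simp: block_corner_eq)

lemma approximates_block_sample:
  assumes d: "1 \<le> d" and \<alpha>: "0 < \<alpha>" "\<alpha> \<le> 1" and F: "lipschitz_taxi \<Lambda> F"
    and supp: "supp F \<subseteq> unit_square" and \<delta>: "4 * \<Lambda> * real d powr (- \<alpha>) \<le> \<delta>"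
  shows "approximates d (zext d (block_sample \<alpha> d F)) F \<delta>"
proof (rule approximatesI[OF d box_supported_zext F supp])
  let ?b = "real (block_length \<alpha> d)"
  have \<Lambda>: "0 \<le> \<Lambda>" using F by (simp add: lipschitz_taxi_def)
  have "\<Lambda> * (2 * (?b / real d)) \<le> \<Lambda> * (2 * (2 * real d powr (- \<alpha>)))"
    using block_length_le[OF d \<alpha>] \<Lambda> by (intro mult_left_mono) auto
  then have \<delta>': "\<Lambda> * (2 * (?b / real d)) \<le> \<delta>" using \<delta> by (simp add: mult_ac)
  have "1 / real d \<le> 2 * (?b / real d)"
    using block_length_pos[of \<alpha> d] by (simp add: divide_right_mono)
  then have "\<Lambda> * (1 / real d) \<le> \<Lambda> * (2 * (?b / real d))"
    using \<Lambda> by (rule mult_left_mono)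
  with \<delta>' show "\<Lambda> / real d \<le> \<delta>" by simp
  fix i j :: int and z :: plane
  assume ij: "(i, j) \<in> {1..int d} \<times> {1..int d}"
    and z: "fst z \<in> {(of_int i - 1) / real d..<of_int i / real d}"
      "snd z \<in> {(of_int j - 1) / real d..<of_int j / real d}"
  have "\<bar>F (block_corner \<alpha> d (nat i), block_corner \<alpha> d (nat j)) - F z\<bar> \<le> \<Lambda> * (?b / real d + ?b / real d)"
    using block_corner_near[OF d _ z(1)] block_corner_near[OF d _ z(2)] ij \<Lambda>
    by (intro order_trans[OF lipschitz_taxiD[OF F]] mult_left_mono add_mono) auto
  with \<delta>' show "\<bar>zext d (block_sample \<alpha> d F) i j - F z\<bar> \<le> \<delta>"
    using ij by (simp add: zext_def block_sample_def)
qed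

subsection \<open>Deformed templates\<close>

text \<open>Moving along one coordinate at a time, the mean value bound for the partial derivatives
  yields the taxicab estimate. The slack up to \<open>C'\<close> permits raising the constant to at
  least 1.\<close>

lemma C1_bounded_imp_lipschitz_taxi:
  assumes a: "C1_bounded C a" and C: "C \<le> C'"
  shows "lipschitz_taxi C' a"
proof -
  obtain g1 g2 where g1: "\<And>u v. ((\<lambda>t. a (t, v)) has_real_derivative g1 (u, v)) (at u)"
    and g2: "\<And>u v. ((\<lambda>t. a (u, t)) has_real_derivative g2 (u, v)) (at v)"
    and b: "\<And>u v. \<bar>g1 (u, v)\<bar> \<le> C" "\<And>u v. \<bar>g2 (u, v)\<bar> \<le> C"
    using a unfolding C1_bounded_def by blast
  have C0: "0 \<le> C" using b(1) abs_ge_zero order_trans by blast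
  have "\<bar>a (u, v) - a (u', v')\<bar> \<le> C' * (\<bar>u - u'\<bar> + \<bar>v - v'\<bar>)" for u v u' v'
  proof -
    have "norm (a (u, v) - a (u', v)) \<le> C * norm (u - u')"
      by (rule field_differentiable_bound[where S = UNIV and f' = "\<lambda>t. g1 (t, v)"]) (use g1 b in auto)
    moreover have "norm (a (u', v) - a (u', v')) \<le> C * norm (v - v')"
      by (rule field_differentiable_bound[where S = UNIV and f' = "\<lambda>t. g2 (u', t)"]) (use g2 b in auto)
    ultimately have "\<bar>a (u, v) - a (u', v')\<bar> \<le> C * (\<bar>u - u'\<bar> + \<bar>v - v'\<bar>)"
      by (simp add: distrib_left)
    also have "\<dots> \<le> C' * (\<bar>u - u'\<bar> + \<bar>v - v'\<bar>)"
      using C by (rule mult_right_mono) auto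
    finally show ?thesis .
  qed
  then show ?thesis using C0 C by (auto simp: lipschitz_taxi_def)
qed

lemma lipschitz_taxi_comp:
  assumes f: "lipschitz_taxi K f" and A: "lipschitz_taxi C (fst \<circ> A)" "lipschitz_taxi C (snd \<circ> A)"
  shows "lipschitz_taxi (2 * K * C) (f \<circ> A)"
proof -
  have K: "0 \<le> K" and C: "0 \<le> C" using f A by (auto simp: lipschitz_taxi_def)
  have "\<bar>f (A z) - f (A z')\<bar> \<le> 2 * K * C * (\<bar>fst z - fst z'\<bar> + \<bar>snd z - snd z'\<bar>)" for z z'
  proof -
    let ?D = "\<bar>fst z - fst z'\<bar> + \<bar>snd z - snd z'\<bar>"
    have "\<bar>f (A z) - f (A z')\<bar> \<le> K * (\<bar>fst (A z) - fst (A z')\<bar> + \<bar>snd (A z) - snd (A z')\<bar>)"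
      by (rule lipschitz_taxiD[OF f])
    also have "\<dots> \<le> K * (C * ?D + C * ?D)"
      using lipschitz_taxiD[OF A(1), of z z'] lipschitz_taxiD[OF A(2), of z z'] K
      by (intro mult_left_mono add_mono) auto
    finally show ?thesis by (simp add: algebra_simps)
  qed
  with K C show ?thesis by (simp add: lipschitz_taxi_def)
qed

text \<open>The Lipschitz constant is proportional to the mass, so mass 0 would make
  \<open>h\<close> constant, hence equal to its value 0 at (2, 2). Since the unit square has area 1,
  a function below half its mass throughout \<open>R\<close> would integrate to too little.\<close>

lemma template_mass:
  assumes h0: "\<And>z. 0 \<le> h z" and nz: "\<exists>z. h z \<noteq> 0" and supp: "supp h \<subseteq> R" and R: "R \<subseteq> unit_square"
    and lip: "lipschitz_taxi (L * L1_norm_unit h) h"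
  shows "0 < L1_norm_unit h" and "\<exists>z\<in>R. L1_norm_unit h / 2 \<le> h z"
proof -
  let ?N = "L1_norm_unit h"
  have N: "?N = (LINT z|lborel. h z)"
    unfolding L1_norm_unit_def set_lebesgue_integral_def
    using supp R h0 by (intro Bochner_Integration.integral_cong) (auto simp: supp_def indicator_def)
  have "0 \<le> ?N" unfolding N using h0 by simp
  moreover have "?N \<noteq> 0"
  proof
    assume "?N = 0"
    obtain z where z: "h z \<noteq> 0" using nz by blast
    have "\<bar>h z - h (2, 2)\<bar> \<le> L * ?N * (\<bar>fst z - 2\<bar> + \<bar>snd z - 2\<bar>)"
      using lipschitz_taxiD[OF lip, of z "(2, 2)"] by simp
    moreover have "h (2, 2) = 0" using supp R by (force simp: supp_def)
    ultimately show False using z \<open>?N = 0\<close> by simp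
  qed
  ultimately show pos: "0 < ?N" by simp
  show "\<exists>z\<in>R. ?N / 2 \<le> h z"
  proof (rule ccontr)
    assume "\<not> ?thesis"
    then have lt: "h z < ?N / 2" if "z \<in> R" for z using that by force
    have I: "has_bochner_integral lborel (\<lambda>z. ?N / 2 * indicator unit_square (z + 0)) (?N / 2 * 1)"
      by (rule has_bochner_integral_mult_right[OF integral_indicator_unit_square_shift])
    have "h z \<le> ?N / 2 * indicator unit_square (z + 0)" for z
    proof (cases "z \<in> R")
      case True
      then show ?thesis using lt[OF True] R by auto
    next
      case False
      then have "h z = 0" using supp by (auto simp: supp_def)
      then show ?thesis using pos by simp
    qed
    then have "(LINT z|lborel. h z) \<le> (LINT z|lborel. ?N / 2 * indicator unit_square (z + 0))"
      using I pos by (intro integral_mono') (auto simp: has_bochner_integral_iff)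
    also have "\<dots> = ?N / 2" using I by (simp only: has_bochner_integral_iff mult_1_right)
    finally show False using pos N by simp
  qed
qed

text \<open>A template exceeds half its mass \<open>N\<close> somewhere in \<open>R\<close>, hence its deformation exceeds \<open>N / 4\<close> on
  a square of half-width \<open>1 / (16 q)\<close>; this gives the lower bound \<open>N\<^sup>2 / (1024 q\<^sup>2)\<close> without any
  change of variables, so that the deformation need not be injective.\<close>

definition deformed_template :: "real \<Rightarrow> real \<Rightarrow> (plane \<Rightarrow> real) \<Rightarrow> bool" where
  "deformed_template q N F \<longleftrightarrow> 0 < N \<and> lipschitz_taxi (2 * q * N) F \<and> supp F \<subseteq> unit_square \<and>
     N\<^sup>2 / (1024 * q\<^sup>2) \<le> (LINT z|lborel. (F z)\<^sup>2)"

lemma deformed_templateI: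
  assumes h0: "\<And>z. 0 \<le> h z" and nz: "\<exists>z. h z \<noteq> 0" and supp: "supp h \<subseteq> R" and R: "R \<subseteq> unit_square"
    and lip: "lipschitz_taxi (L * L1_norm_unit h) h"
    and A: "lipschitz_taxi C (fst \<circ> A)" "lipschitz_taxi C (snd \<circ> A)"
    and vis: "R \<subseteq> A ` unit_square" "supp (h \<circ> A) \<subseteq> unit_square" and pos: "0 < L" "0 < C"
  shows "deformed_template (L * C) (L1_norm_unit h) (h \<circ> A)"
proof -
  let ?N = "L1_norm_unit h"
  note m = template_mass[OF h0 nz supp R lip]
  have lipA: "lipschitz_taxi (2 * (L * C) * ?N) (h \<circ> A)"
    using lipschitz_taxi_comp[OF lip A] by (simp add: mult_ac)
  obtain z where z: "z \<in> R" "?N / 2 \<le> h z" using m(2) by blast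
  then obtain w where w: "z = A w" using vis(1) by blast
  \<comment> \<open>The half-width 1/(16 L C) gives equality in 4 \<Lambda> r <= v for \<Lambda> = 2
    L C N and v = N/2.\<close>
  have "(?N / 2)\<^sup>2 * (1 / (16 * (L * C)))\<^sup>2 \<le> (LINT z|lborel. ((h \<circ> A) z)\<^sup>2)"
    using m(1) pos z w by (intro integral_square_ge[OF lipA vis(2), of _ w]) (auto simp: field_simps)
  then have "?N\<^sup>2 / (1024 * (L * C)\<^sup>2) \<le> (LINT z|lborel. ((h \<circ> A) z)\<^sup>2)"
    by (simp add: power2_eq_square)
  with m(1) lipA vis(2) show ?thesis by (simp add: deformed_template_def)
qed

text \<open>A real \<open>SUP\<close> dominates its members only over a bounded set; boundedness
  comes from continuity on the compact unit square.\<close>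

lemma sup_norm_unit_ge:
  assumes "lipschitz_taxi C (fst \<circ> A)" "lipschitz_taxi C (snd \<circ> A)"
    and "lipschitz_taxi C (fst \<circ> B)" "lipschitz_taxi C (snd \<circ> B)" and z: "z \<in> unit_square"
  shows "\<bar>fst (B z) - fst (A z)\<bar> \<le> sup_norm_unit (\<lambda>z. B z - A z)"
    and "\<bar>snd (B z) - snd (A z)\<bar> \<le> sup_norm_unit (\<lambda>z. B z - A z)"
proof -
  have bdd: "bdd_above ((\<lambda>z. \<bar>b z - a z\<bar>) ` unit_square)"
    if a: "lipschitz_taxi C a" and b: "lipschitz_taxi C b" for a b :: "plane \<Rightarrow> real"
  proof -
    have "compact unit_square" by (intro compact_Times) auto
    moreover have "continuous_on unit_square (\<lambda>z. \<bar>b z - a z\<bar>)"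
      using continuous_on_subset[OF lipschitz_taxi_continuous[OF a] subset_UNIV]
        continuous_on_subset[OF lipschitz_taxi_continuous[OF b] subset_UNIV]
      by (intro continuous_intros)
    ultimately show ?thesis
      by (intro bounded_imp_bdd_above compact_imp_bounded compact_continuous_image)
  qed
  show "\<bar>fst (B z) - fst (A z)\<bar> \<le> sup_norm_unit (\<lambda>z. B z - A z)"
    unfolding sup_norm_unit_def using bdd[OF assms(1,3)] z
    by (intro max.coboundedI1 cSUP_upper2[where x = z]) (auto simp: comp_def)
  show "\<bar>snd (B z) - snd (A z)\<bar> \<le> sup_norm_unit (\<lambda>z. B z - A z)"
    unfolding sup_norm_unit_def using bdd[OF assms(2,4)] z
    by (intro max.coboundedI2 cSUP_upper2[where x = z]) (auto simp: comp_def)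
qed

lemma shift_map_eq: "shift_map s s' A z = A (z + (s, s'))"
  by (cases z) (simp add: shift_map_def)

text \<open>The sup norm controls the two maps on the unit square only; elsewhere full visibility
  makes both deformed templates vanish.\<close>

lemma comp_close:
  assumes f: "lipschitz_taxi K f" and A: "lipschitz_taxi C (fst \<circ> A)" "lipschitz_taxi C (snd \<circ> A)"
    and B: "lipschitz_taxi C (fst \<circ> B)" "lipschitz_taxi C (snd \<circ> B)"
    and supp: "supp (f \<circ> A) \<subseteq> unit_square" "supp (f \<circ> B) \<subseteq> unit_square"
    and h: "sup_norm_unit (\<lambda>z. B z - A z) \<le> h"
  shows "\<bar>f (B z) - f (A z)\<bar> \<le> 2 * K * h * indicator unit_square z"
proof (cases "z \<in> unit_square")
  case True
  have "\<bar>f (B z) - f (A z)\<bar> \<le> K * (\<bar>fst (B z) - fst (A z)\<bar> + \<bar>snd (B z) - snd (A z)\<bar>)"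
    by (rule lipschitz_taxiD[OF f])
  also have "\<dots> \<le> K * (h + h)"
    using sup_norm_unit_ge[OF A B True] h f
    by (intro mult_left_mono add_mono) (auto simp: lipschitz_taxi_def)
  finally show ?thesis using True by (simp add: algebra_simps)
next
  case False
  then have "f (B z) = 0" "f (A z) = 0" using supp by (auto simp: supp_def)
  with False show ?thesis by simp
qed

text \<open>The last condition on \<open>h\<close> says that 3 \<delta>^2, with \<delta> = 8 q N h,
  takes at most a quarter of the bound N^2/(1024 q^2); division by the factor 3 of
  \<open>sqnorm_ge\<close> leaves N^2/(4096 q^2). Above, a deformed template is at most 4 q N and
  the error at most 8 q N.\<close>

lemma deformed_template_bounds:
  assumes F: "deformed_template q N F" and X: "approximates d X F (8 * q * N * h)"
    and q: "0 < q" and h: "0 < h" "h \<le> 1" "64 * q\<^sup>2 * h * 12288 * q\<^sup>2 \<le> 1"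
  shows "N\<^sup>2 / (4096 * q\<^sup>2) * (real d)\<^sup>2 \<le> sqnorm d X"
    and "sqnorm d X \<le> (12 * q * N)\<^sup>2 * (real d)\<^sup>2"
proof -
  have N: "0 < N" and lip: "lipschitz_taxi (2 * q * N) F" and supp: "supp F \<subseteq> unit_square"
    and E: "N\<^sup>2 / (1024 * q\<^sup>2) \<le> (LINT z|lborel. (F z)\<^sup>2)"
    using F by (auto simp: deformed_template_def)
  have d: "1 \<le> d" using X by (simp add: approximates_def)
  have "(64 * q\<^sup>2 * h * 12288 * q\<^sup>2) * (h * N\<^sup>2) \<le> 1 * (1 * N\<^sup>2)"
    using h by (intro mult_mono) auto
  then have "(8 * q * N * h)\<^sup>2 \<le> N\<^sup>2 / (12288 * q\<^sup>2)"
    using q by (simp add: field_simps power2_eq_square)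
  then have "N\<^sup>2 / (4096 * q\<^sup>2) \<le> sqnorm d X / (real d)\<^sup>2"
    using order_trans[OF E sqnorm_ge[OF X]] q by (simp add: field_simps)
  then show "N\<^sup>2 / (4096 * q\<^sup>2) * (real d)\<^sup>2 \<le> sqnorm d X"
    using d by (simp add: pos_le_divide_eq)
  have "sqnorm d X / (real d)\<^sup>2 \<le> (2 * (2 * q * N) + 8 * q * N * h)\<^sup>2"
    using lipschitz_taxi_bound[OF lip supp] q N by (intro sqnorm_le[OF X]) auto
  also have "\<dots> \<le> (12 * q * N)\<^sup>2"
    using q N h by (intro power_mono) (auto simp: mult_left_le)
  finally show "sqnorm d X \<le> (12 * q * N)\<^sup>2 * (real d)\<^sup>2"
    using d by (simp add: pos_divide_le_eq)
qed

text \<open>Cauchy-Schwarz: the squared distance from \<open>X\<close> to its projection on the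
  shifted \<open>Y\<close> is x^2 (1 - \<rho>^2), and up to d^2 it is the integral of a
  square.\<close>

lemma cosine_square_le_1:
  assumes d: "1 \<le> d" and Y: "box_supported d Y" and X: "box_supported d X"
    and pos: "0 < sqnorm d Y" "0 < sqnorm d X"
  shows "(cosine d Y X s s')\<^sup>2 \<le> 1"
proof -
  define y x where "y = sqrt (sqnorm d Y)" and "x = sqrt (sqnorm d X)"
  define \<rho> where "\<rho> = cosine d Y X s s'"
  have p: "0 < y" "0 < x" using pos by (simp_all add: x_def y_def)
  have sq: "y\<^sup>2 = sqnorm d Y" "x\<^sup>2 = sqnorm d X"
    by (simp_all add: x_def y_def sqnorm_nonneg)
  have c: "corr d Y X s s' = \<rho> * (y * x)"
    using p by (simp add: \<rho>_def cosine_def x_def y_def)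
  define a where "a = \<rho> * x / y"
  let ?I = "\<lambda>z. (a * grid d Y (z + (of_int s / real d, of_int s' / real d)) - grid d X z)\<^sup>2"
  have "integral\<^sup>L lborel ?I = (a\<^sup>2 * sqnorm d Y - 2 * a * corr d Y X s s' + sqnorm d X) / (real d)\<^sup>2"
    unfolding sqnorm_def by (rule has_bochner_integral_integral_eq[OF has_integral_grid_diff_square[OF d Y X]])
  moreover have "0 \<le> integral\<^sup>L lborel ?I"
    by (rule Bochner_Integration.integral_nonneg) simp
  ultimately have "0 \<le> (a\<^sup>2 * sqnorm d Y - 2 * a * corr d Y X s s' + sqnorm d X) / (real d)\<^sup>2"
    by simp
  moreover have "a\<^sup>2 * sqnorm d Y - 2 * a * corr d Y X s s' + sqnorm d X = x\<^sup>2 * (1 - \<rho>\<^sup>2)"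
    unfolding c sq[symmetric] a_def using p by (simp add: power2_eq_square field_simps)
  ultimately show ?thesis
    using d p by (simp add: zero_le_divide_iff zero_le_mult_iff \<rho>_def)
qed

text \<open>The bound on \<kappa> is read off the error estimate: 432 = 3 * 12^2 multiplies 1 -
  \<rho>^2, and 1728 = 4 * 432 makes this factor at least 4 K h. The other two summands pay for
  discretising \<open>F\<close>, rescaled by the norm ratio, and \<open>G\<close>; 1024 q^2 comes
  from the norm of the template in the separation. Both masses cancel.\<close>

lemma cosine_le_of_separated:
  assumes F: "deformed_template q NF F" and G: "deformed_template q NG G"
    and Y: "approximates d Y F (8 * q * NF * h)" and X: "approximates d X G (8 * q * NG * h)"
    and q: "0 < q" and h: "0 < h" "h \<le> 1" "64 * q\<^sup>2 * h * 12288 * q\<^sup>2 \<le> 1"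
    and sep: "\<And>a. \<kappa> * h * (NG\<^sup>2 / (1024 * q\<^sup>2))
      \<le> (LINT z|lborel. (a * F (z + (of_int s / real d, of_int s' / real d)) - G z)\<^sup>2)"
    and \<kappa>: "\<kappa> \<ge> 1024 * q\<^sup>2 * (1728 * q\<^sup>2 * K + 432 * 64 * 4096 * q^6 + 192 * q\<^sup>2)"
    and K: "0 < K" "2 * K * h \<le> 1"
  shows "cosine d Y X s s' \<le> 1 - 2 * K * h"
proof -
  define \<rho> where "\<rho> = cosine d Y X s s'"
  have N: "0 < NF" "0 < NG" using F G by (auto simp: deformed_template_def)
  have d: "1 \<le> d" and bY: "box_supported d Y" and bX: "box_supported d X"
    using X Y by (auto simp: approximates_def)
  note bF = deformed_template_bounds[OF F Y q h] and bG = deformed_template_bounds[OF G X q h]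
  have pos: "0 < N\<^sup>2 / (4096 * q\<^sup>2) * (real d)\<^sup>2" if "0 < N" for N
    using that d q by simp
  have posY: "0 < sqnorm d Y" and posX: "0 < sqnorm d X"
    using pos[OF N(1)] pos[OF N(2)] bF(1) bG(1) by linarith+
  have \<rho>1: "\<rho>\<^sup>2 \<le> 1"
    unfolding \<rho>_def by (rule cosine_square_le_1[OF d bY bX posY posX])
  have sX: "sqnorm d X / (real d)\<^sup>2 \<le> (12 * q * NG)\<^sup>2"
    using bG(2) d by (simp add: pos_divide_le_eq)
  have "sqnorm d X / sqnorm d Y \<le> ((12 * q * NG)\<^sup>2 * (real d)\<^sup>2) / (NF\<^sup>2 / (4096 * q\<^sup>2) * (real d)\<^sup>2)"
    using bG(2) bF(1) posX pos[OF N(1)] by (intro frac_le) auto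
  also have "\<dots> = 144 * 4096 * q^4 * NG\<^sup>2 / NF\<^sup>2"
    using N d q by (simp add: field_simps power2_eq_square power4_eq_xxxx)
  finally have ratio: "sqnorm d X / sqnorm d Y \<le> 144 * 4096 * q^4 * NG\<^sup>2 / NF\<^sup>2" .
  have "\<kappa> * h * (NG\<^sup>2 / (1024 * q\<^sup>2)) \<le> 3 * (sqnorm d X / (real d)\<^sup>2) * (1 - \<rho>\<^sup>2)
     + 3 * \<rho>\<^sup>2 * (sqnorm d X / sqnorm d Y) * (8 * q * NF * h)\<^sup>2 + 3 * (8 * q * NG * h)\<^sup>2"
    unfolding \<rho>_def by (rule separated_imp_cosine[OF Y X sep posY posX])
  also have "\<dots> \<le> 3 * (12 * q * NG)\<^sup>2 * (1 - \<rho>\<^sup>2)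
     + 3 * 1 * (144 * 4096 * q^4 * NG\<^sup>2 / NF\<^sup>2) * (8 * q * NF * h)\<^sup>2 + 3 * (8 * q * NG * h)\<^sup>2"
    using sX ratio \<rho>1 posX posY by (intro add_mono mult_mono order_refl) auto
  also have "\<dots> = NG\<^sup>2 * (432 * q\<^sup>2 * (1 - \<rho>\<^sup>2) + (432 * 64 * 4096 * q^6 + 192 * q\<^sup>2) * h\<^sup>2)"
    using N by (simp add: field_simps power_mult_distrib)
  finally have "NG\<^sup>2 * (\<kappa> * h / (1024 * q\<^sup>2))
      \<le> NG\<^sup>2 * (432 * q\<^sup>2 * (1 - \<rho>\<^sup>2) + (432 * 64 * 4096 * q^6 + 192 * q\<^sup>2) * h\<^sup>2)"
    by (simp add: mult_ac)
  then have up: "\<kappa> * h / (1024 * q\<^sup>2) \<le> 432 * q\<^sup>2 * (1 - \<rho>\<^sup>2) + (432 * 64 * 4096 * q^6 + 192 * q\<^sup>2) * h\<^sup>2"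
    using N by (subst (asm) mult_le_cancel_left_pos) auto
  \<comment> \<open>\<open>P\<close> collects the two discretisation errors. They are of order h^2,
    hence at most \<open>P * h\<close>, which \<kappa> has in reserve.\<close>
  define P where "P = 432 * 64 * 4096 * q^6 + 192 * q\<^sup>2"
  have P0: "0 \<le> P" by (simp add: P_def)
  have "h\<^sup>2 \<le> h" using h by (simp add: power2_eq_square mult_left_le)
  then have "P * h\<^sup>2 \<le> P * h" using P0 by (rule mult_left_mono)
  moreover have "1728 * q\<^sup>2 * K + P \<le> \<kappa> / (1024 * q\<^sup>2)"
    using \<kappa> q unfolding P_def by (simp only: pos_le_divide_eq mult.commute[of "1024 * q\<^sup>2"] add.assoc zero_less_mult_iff zero_less_power zero_less_numeral simp_thms)
  then have "(1728 * q\<^sup>2 * K + P) * h \<le> \<kappa> / (1024 * q\<^sup>2) * h"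
    using h by (intro mult_right_mono) auto
  then have "1728 * q\<^sup>2 * K * h + P * h \<le> \<kappa> * h / (1024 * q\<^sup>2)"
    unfolding distrib_right by (simp only: times_divide_eq_left)
  ultimately have "1728 * q\<^sup>2 * K * h \<le> 432 * q\<^sup>2 * (1 - \<rho>\<^sup>2)"
    using up unfolding P_def[symmetric] by linarith
  moreover have "1728 * q\<^sup>2 * K * h = (432 * q\<^sup>2) * (4 * K * h)" by simp
  ultimately have "(432 * q\<^sup>2) * (4 * K * h) \<le> (432 * q\<^sup>2) * (1 - \<rho>\<^sup>2)" by simp
  then have "4 * K * h \<le> 1 - \<rho>\<^sup>2"
    using q by (subst (asm) mult_le_cancel_left_pos) auto
  then have le: "4 * K * h \<le> (1 - \<rho>) * (1 + \<rho>)" by (simp add: power2_eq_square algebra_simps)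
  \<comment> \<open>For \<rho> >= 0 the factor 1 + \<rho> is at most 2, which halves the gap; for
    negative \<rho> the bound 2 K h <= 1 suffices.\<close>
  show ?thesis
  proof (cases "0 \<le> \<rho>")
    case True
    have "\<rho> \<le> 1" using abs_square_le_1[THEN iffD1, OF \<rho>1] by simp
    then have "(1 - \<rho>) * (1 + \<rho>) \<le> (1 - \<rho>) * 2" by (intro mult_left_mono) auto
    with le show ?thesis by (simp add: \<rho>_def)
  next
    case False
    then show ?thesis using K by (simp add: \<rho>_def)
  qed
qed

text \<open>Here 288 = 9 * 8^2 / 2 comes from \<open>cosine_ge\<close> with accuracy 8 q N h, and
  4096 from the lower norm bound. The loss is of order h^2, weakened to order \<open>h\<close> by h
  <= 1.\<close>

lemma cosine_ge_of_close:
  assumes F: "deformed_template q N F" and G: "deformed_template q N G"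
    and Y: "approximates d Y F (8 * q * N * h)" and X: "approximates d X G (8 * q * N * h)"
    and q: "0 < q" and h: "0 < h" "h \<le> 1" "64 * q\<^sup>2 * h * 12288 * q\<^sup>2 \<le> 1"
    and close: "\<And>z. \<bar>F (z + (of_int s / real d, of_int s' / real d)) - G z\<bar> \<le> 8 * q * N * h * indicator unit_square z"
  shows "1 - 288 * 4096 * q^4 * h \<le> cosine d Y X s s'"
proof -
  have N: "0 < N" using F by (auto simp: deformed_template_def)
  have "1 - 9 * (8 * q * N * h)\<^sup>2 / (2 * (N\<^sup>2 / (4096 * q\<^sup>2))) \<le> cosine d Y X s s'"
    by (rule cosine_ge[OF Y X close])
      (use N q deformed_template_bounds(1)[OF F Y q h] deformed_template_bounds(1)[OF G X q h] in auto)
  moreover have "9 * (8 * q * N * h)\<^sup>2 / (2 * (N\<^sup>2 / (4096 * q\<^sup>2))) = 288 * 4096 * q^4 * h\<^sup>2"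
    using N q by (simp add: field_simps power_mult_distrib)
  moreover have "288 * 4096 * q^4 * h\<^sup>2 \<le> 288 * 4096 * q^4 * h"
    using h by (intro mult_left_mono) (auto simp: power2_eq_square mult_left_le)
  ultimately show ?thesis by linarith
qed

subsection \<open>Separation of the features\<close>

lemma zext_normalized: "zext d (normalized d w) i j = zext d w i j / sqrt (sqnorm d (zext d w))"
proof -
  have "sqnorm d (zext d w) = (\<Sum>j'=1..d. \<Sum>l'=1..d. (w j' l')\<^sup>2)"
    unfolding sqnorm_def box_sum_nat sum.cartesian_product
    by (intro sum.cong refl) (auto simp: zext_def)
  then show ?thesis by (simp add: zext_def normalized_def)
qed

lemma corr_normalized:
  "corr d (zext d (normalized d w)) (zext d (normalized d x)) s s' = cosine d (zext d w) (zext d x) s s'"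
  by (simp add: corr_def cosine_def box_sum_def zext_normalized sum_divide_distrib case_prod_beta)

lemma abs_normalized_le_1:
  assumes "i \<in> {1..d}" "j \<in> {1..d}"
  shows "\<bar>normalized d w i j\<bar> \<le> 1"
proof -
  have "(w i j)\<^sup>2 \<le> (\<Sum>l'=1..d. (w i l')\<^sup>2)"
    using assms by (intro member_le_sum) auto
  also have "\<dots> \<le> (\<Sum>j'=1..d. \<Sum>l'=1..d. (w j' l')\<^sup>2)"
    using assms by (intro member_le_sum[of i _ "\<lambda>j'. \<Sum>l'=1..d. (w j' l')\<^sup>2"]) (auto intro: sum_nonneg)
  finally have "\<bar>w i j\<bar> \<le> sqrt (\<Sum>j'=1..d. \<Sum>l'=1..d. (w j' l')\<^sup>2)"
    by (metis real_sqrt_abs real_sqrt_le_iff)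
  moreover from this have "0 \<le> sqrt (\<Sum>j'=1..d. \<Sum>l'=1..d. (w j' l')\<^sup>2)"
    by (rule order_trans[OF abs_ge_zero])
  ultimately show ?thesis
    unfolding normalized_def by (simp add: abs_divide divide_le_eq_1) linarith
qed

lemma block_structure_normalized:
  assumes "block_structure \<alpha> d w"
  shows "block_structure \<alpha> d (normalized d w)"
proof (cases "\<alpha> = 1")
  case False
  then have w: "w j l = w j' l'" if "i \<ge> 1" "i' \<ge> 1" "j \<in> block \<alpha> d i" "j' \<in> block \<alpha> d i"
    "l \<in> block \<alpha> d i'" "l' \<in> block \<alpha> d i'" for i i' j j' l l'
    using assms that unfolding block_structure_def by blast
  show ?thesis
    unfolding block_structure_def normalized_def
    by (intro disjI2 allI ballI impI arg_cong2[of _ _ _ _ "(/)"] refl) (rule w)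
qed (simp add: block_structure_def)

text \<open>Normalisation cancels the brightness, which reduces all feature estimates to brightness
  1.\<close>

lemma normalized_image_of:
  assumes "0 < \<eta>"
  shows "normalized d (image_of d f A \<eta>) = normalized d (image_of d f A 1)"
proof -
  have *: "image_of d f A \<eta> j l = \<eta> * image_of d f A 1 j l" for j l
    by (simp add: image_of_def)
  show ?thesis
    unfolding normalized_def * using assms
    by (simp add: power_mult_distrib sum_distrib_left[symmetric] real_sqrt_mult)
qed

lemma sep_dir_lower:
  assumes b: "0 \<le> b" "b \<le> sep_dir \<A> f g" and A: "A \<in> \<A>" "A' \<in> \<A>" and g: "0 < (LINT z|lborel. (g z)\<^sup>2)"
  shows "b\<^sup>2 * (LINT z|lborel. (g z)\<^sup>2) \<le> (LINT z|lborel. (a * f (A (z + (s, s'))) - g (A' z))\<^sup>2)"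
proof -
  let ?I = "LINT z|lborel. (a * f (A (z + (s, s'))) - g (A' z))\<^sup>2"
  have "sep_dir \<A> f g \<le> L2_norm_plane (\<lambda>z. a * f (shift_map s s' A z) - g (A' z)) / L2_norm_plane g"
    unfolding sep_dir_def
    by (rule cInf_lower) (use A in \<open>blast, auto intro!: bdd_belowI[of _ 0] simp: L2_norm_plane_def\<close>)
  with b have "b \<le> sqrt ?I / sqrt (LINT z|lborel. (g z)\<^sup>2)"
    unfolding L2_norm_plane_def shift_map_eq by linarith
  then have "b * sqrt (LINT z|lborel. (g z)\<^sup>2) \<le> sqrt ?I"
    using g by (simp add: pos_le_divide_eq)
  then have "(b * sqrt (LINT z|lborel. (g z)\<^sup>2))\<^sup>2 \<le> (sqrt ?I)\<^sup>2"
    using b g by (intro power_mono) auto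
  moreover have "0 \<le> ?I" by simp
  ultimately show ?thesis
    using g by (simp add: power_mult_distrib del: Bochner_Integration.integral_nonneg)
qed

text \<open>The scalar 0 removes the other template. Combined with the separation hypothesis, this
  is the source of every smallness condition on d^-alpha.\<close>

lemma sep_dir_le_1:
  assumes "id \<in> \<A>"
  shows "sep_dir \<A> f g \<le> 1"
proof -
  have "sep_dir \<A> f g \<le> L2_norm_plane (\<lambda>z. 0 * f (shift_map 0 0 id z) - g (id z)) / L2_norm_plane g"
    unfolding sep_dir_def
    by (rule cInf_lower) (use assms in \<open>blast, auto intro!: bdd_belowI[of _ 0] simp: L2_norm_plane_def\<close>)
  also have "\<dots> \<le> 1" by (simp add: L2_norm_plane_def)
  finally show ?thesis .
qed

text \<open>Throughout, \<open>q = C\<^sub>L max(1, C\<^sub>A)\<close>. The matching filter loses at most \<open>match_const q / d\<^sup>\<alpha>\<close> in the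
  cosine. The three summands of \<open>sep_const\<close> ensure, in this order, that other filters lose at least
  twice as much, that discretisation at most halves norms, and that the threshold is nonnegative.\<close>

definition match_const :: "real \<Rightarrow> real" where
  "match_const q = 288 * 4096 * q^4"

definition sep_const :: "real \<Rightarrow> real" where
  "sep_const q = 1024 * q\<^sup>2 * (1728 * q\<^sup>2 * match_const q + 432 * 64 * 4096 * q^6 + 192 * q\<^sup>2)
     + 64 * q\<^sup>2 * 12288 * q\<^sup>2 + 2 * match_const q"

text \<open>The threshold \<open>t\<close> admits every wrong-class filter with equality, while the
  best right-class filter loses only half as much and so passes strictly. All of this holds for each
  deformation; probability enters only later.\<close>

lemma features_separate:
  fixes C\<^sub>L C\<^sub>A \<alpha> :: real
  defines "q \<equiv> C\<^sub>L * max 1 C\<^sub>A"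
  assumes L: "0 < C\<^sub>L" and d: "1 \<le> d" and templ: "templates f"
    and a1: "assumption_1 C\<^sub>L R f" and a2: "assumption_2i C\<^sub>A R f \<A>" and a3: "assumption_3 d C\<^sub>A R f \<A> A_fin"
    and \<alpha>: "0 < \<alpha>" "\<alpha> \<le> 1" and sep: "separation \<A> (f 0) (f 1) \<ge> sqrt (sep_const q / real d powr \<alpha>)"
  defines "t \<equiv> 1 - 2 * match_const q * real d powr (- \<alpha>)"
  defines "feature \<equiv> \<lambda>i A' k A. cnn_feature d (normalized d (block_sample \<alpha> d (f i \<circ> A'))) (normalized d (image_of d (f k) A 1))"
  shows "\<bar>t\<bar> \<le> 1"
    and "k \<in> {0, 1} \<Longrightarrow> A \<in> \<A> \<Longrightarrow> \<exists>A'\<in>A_fin \<alpha>. t < feature k A' k A"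
    and "k \<in> {0, 1} \<Longrightarrow> i \<in> {0, 1} \<Longrightarrow> i \<noteq> k \<Longrightarrow> A \<in> \<A> \<Longrightarrow> A' \<in> A_fin \<alpha> \<Longrightarrow> feature i A' k A \<le> t"
proof -
  define C where "C = max 1 C\<^sub>A"
  define h where "h = real d powr (- \<alpha>)"
  define N where "N i = L1_norm_unit (f i)" for i
  let ?K = "match_const q"
  have q: "0 < q" and C: "1 \<le> C" "C\<^sub>A \<le> C" and qC: "q = C\<^sub>L * C"
    using L by (auto simp: q_def C_def)
  \<comment> \<open>The maximum with 1 in \<open>q\<close> is used here: the constant of an
    undeformed template must not exceed \<open>q\<close> times its mass.\<close>
  have Lq: "C\<^sub>L \<le> q" using L C by (simp add: qC)
  have K: "0 < ?K" using q by (simp add: match_const_def)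
  have hd: "sep_const q / real d powr \<alpha> = sep_const q * h"
    using d by (simp add: h_def powr_minus_divide)
  have h: "0 < h" using d by (simp add: h_def)
  have h1: "h \<le> 1" unfolding h_def using ge_one_powr_ge_zero[of "real d" \<alpha>] \<alpha> d
    by (simp add: powr_minus_divide divide_le_eq_1)
  have dh: "1 / real d \<le> h"
    using powr_mono[of "-1" "-\<alpha>" "real d"] \<alpha> d by (simp add: h_def powr_minus_divide)
  have pos: "0 < sep_const q"
    unfolding sep_const_def using q K by (intro add_pos_pos mult_pos_pos) auto
  \<comment> \<open>From D <= 1 follows \<open>sep_const q * h\<close> <= 1, and the summands of
    \<open>sep_const\<close> then deliver the conditions \<open>hq\<close> and
    \<open>hK\<close>.\<close>
  have "separation \<A> (f 0) (f 1) \<le> 1"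
    unfolding separation_def using a2 by (intro max.boundedI sep_dir_le_1) (auto simp: assumption_2i_def)
  then have "sqrt (sep_const q * h) \<le> 1"
    using sep unfolding hd by linarith
  then have \<kappa>1: "sep_const q * h \<le> 1" by (subst (asm) real_sqrt_le_1_iff)
  have "64 * q\<^sup>2 * 12288 * q\<^sup>2 \<le> sep_const q" "2 * ?K \<le> sep_const q"
    and \<kappa>: "1024 * q\<^sup>2 * (1728 * q\<^sup>2 * ?K + 432 * 64 * 4096 * q^6 + 192 * q\<^sup>2) \<le> sep_const q"
    unfolding sep_const_def using q K by simp_all
  then have "64 * q\<^sup>2 * 12288 * q\<^sup>2 * h \<le> sep_const q * h" "2 * ?K * h \<le> sep_const q * h"
    using mult_right_mono[OF _ less_imp_le[OF h]] by blast+
  with \<kappa>1 have hq: "64 * q\<^sup>2 * h * 12288 * q\<^sup>2 \<le> 1" and hK: "2 * ?K * h \<le> 1"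
    by (simp_all add: mult_ac)
  have t: "t = 1 - 2 * ?K * h" by (simp add: t_def h_def)
  show "\<bar>t\<bar> \<le> 1" using hK K h by (simp add: t abs_le_iff)

  have f0: "\<And>z. 0 \<le> f i z" and nz: "\<exists>z. f i z \<noteq> 0" and supp: "supp (f i) \<subseteq> R"
    and lip: "lipschitz_taxi (C\<^sub>L * N i) (f i)" if "i \<in> {0, 1}" for i
  proof -
    show "\<And>z. 0 \<le> f i z" "\<exists>z. f i z \<noteq> 0" "supp (f i) \<subseteq> R"
      using that templ a1 unfolding templates_def assumption_1_def by blast+
    have "0 \<le> N i"
      unfolding N_def L1_norm_unit_def set_lebesgue_integral_def by (rule Bochner_Integration.integral_nonneg) simp
    then show "lipschitz_taxi (C\<^sub>L * N i) (f i)"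
      using that a1 L unfolding lipschitz_taxi_def assumption_1_def N_def by auto
  qed
  have R: "R \<subseteq> unit_square" using a1 by (simp add: assumption_1_def)
  have comps: "lipschitz_taxi C (fst \<circ> A)" "lipschitz_taxi C (snd \<circ> A)" if "admissible_map C\<^sub>A R f A" for A
    using that C by (auto simp: admissible_map_def intro: C1_bounded_imp_lipschitz_taxi)
  have vis: "supp (f i \<circ> A) \<subseteq> unit_square" if "admissible_map C\<^sub>A R f A" "i \<in> {0, 1}" for A i
    using that unfolding admissible_map_def by blast
  have deformed: "deformed_template q (N i) (f i \<circ> A)" if i: "i \<in> {0, 1}" and A: "admissible_map C\<^sub>A R f A" for i A
    unfolding qC N_def
    by (rule deformed_templateI[OF f0[OF i] nz[OF i] supp[OF i] R lip[OF i, unfolded N_def] comps[OF A] _ vis[OF A i]])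
      (use A L C in \<open>auto simp: admissible_map_def\<close>)
  have adm: "admissible_map C\<^sub>A R f A" if "A \<in> \<A>" for A
    using that a2 by (simp add: assumption_2i_def)
  have fin: "A_fin \<alpha> \<subseteq> \<A>"
    using a3 \<alpha> by (simp add: assumption_3_def)
  have idA: "id \<in> \<A>" using a2 by (simp add: assumption_2i_def)
  have Npos: "0 < N i" if "i \<in> {0, 1}" for i
    using deformed[OF that adm[OF idA]] by (simp add: deformed_template_def)

  have image: "approximates d (zext d (image_of d (f i) A 1)) (f i \<circ> A) (8 * q * N i * h)"
    and sample: "approximates d (zext d (block_sample \<alpha> d (f i \<circ> A))) (f i \<circ> A) (8 * q * N i * h)"
    if i: "i \<in> {0, 1}" and A: "A \<in> \<A>" for i A
  proof -
    have l: "lipschitz_taxi (2 * q * N i) (f i \<circ> A)" and s: "supp (f i \<circ> A) \<subseteq> unit_square"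
      using deformed[OF i adm[OF A]] by (auto simp: deformed_template_def)
    \<comment> \<open>Pixel averaging costs only twice the Lipschitz constant over \<open>d\<close>;
      block sampling needs the full 8 q N h, which is taken as common accuracy.\<close>
    have "(4 * q * N i) * (1 / real d) \<le> (8 * q * N i) * h"
      using dh q Npos[OF i] by (intro mult_mono) auto
    then show "approximates d (zext d (image_of d (f i) A 1)) (f i \<circ> A) (8 * q * N i * h)"
      by (intro approximates_image[OF d l s]) simp
    show "approximates d (zext d (block_sample \<alpha> d (f i \<circ> A))) (f i \<circ> A) (8 * q * N i * h)"
      by (intro approximates_block_sample[OF d \<alpha> l s]) (simp add: h_def)
  qed

  show "\<exists>A'\<in>A_fin \<alpha>. t < feature k A' k A" if k: "k \<in> {0, 1}" and A: "A \<in> \<A>"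
  proof -
    obtain A' j l where A': "A' \<in> A_fin \<alpha>"
      and B: "admissible_map C\<^sub>A R f (shift_map (real j / real d) (real l / real d) A')"
      and near: "sup_norm_unit (\<lambda>z. shift_map (real j / real d) (real l / real d) A' z - A z) \<le> h"
      using a3 \<alpha> A unfolding assumption_3_def h_def by blast
    have A'A: "A' \<in> \<A>" using A' fin by blast
    have le: "2 * (C\<^sub>L * N k) * h \<le> 8 * q * N k * h"
      using Lq L Npos[OF k] h by (intro mult_right_mono) auto
    have "1 - 288 * 4096 * q^4 * h
        \<le> cosine d (zext d (block_sample \<alpha> d (f k \<circ> A'))) (zext d (image_of d (f k) A 1)) (int j) (int l)"
    proof (rule cosine_ge_of_close[OF deformed[OF k adm[OF A'A]] deformed[OF k adm[OF A]] sample[OF k A'A] image[OF k A] q h h1 hq])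
      fix z :: plane
      have "\<bar>f k (A' (z + (real j / real d, real l / real d))) - f k (A z)\<bar> \<le> 2 * (C\<^sub>L * N k) * h * indicator unit_square z"
        using comp_close[OF lip[OF k] comps[OF adm[OF A]] comps[OF B] vis[OF adm[OF A] k] vis[OF B k] near, of z]
        by (simp add: shift_map_eq)
      also have "\<dots> \<le> 8 * q * N k * h * indicator unit_square z"
        using le by (rule mult_right_mono) simp
      finally show "\<bar>(f k \<circ> A') (z + (of_int (int j) / real d, of_int (int l) / real d)) - (f k \<circ> A) z\<bar>
          \<le> 8 * q * N k * h * indicator unit_square z"
        by simp
    qed
    also have "\<dots> \<le> feature k A' k A"
      unfolding feature_def corr_normalized[symmetric] by (rule cnn_feature_ge)
    finally have "1 - ?K * h \<le> feature k A' k A" by (simp add: match_const_def)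
    moreover have "0 < ?K * h" using K h by simp
    ultimately show ?thesis using A' t by (intro bexI[of _ A']) auto
  qed

  show "feature i A' k A \<le> t"
    if k: "k \<in> {0, 1}" and i: "i \<in> {0, 1}" and ik: "i \<noteq> k" and A: "A \<in> \<A>" and A'fin: "A' \<in> A_fin \<alpha>"
    unfolding feature_def
  proof (rule cnn_feature_le)
    \<comment> \<open>A rectified feature is never negative, so a bound on all correlations bounds
      it only if nonnegative.\<close>
    show "0 \<le> t" using hK t by simp
    fix s s' :: int
    have A': "A' \<in> \<A>" using A'fin fin by blast
    let ?Y = "zext d (block_sample \<alpha> d (f i \<circ> A'))" and ?X = "zext d (image_of d (f k) A 1)"
    have lower: "sep_const q * h * ((N j)\<^sup>2 / (1024 * q\<^sup>2))
        \<le> (LINT z|lborel. (a * (f i \<circ> B) (z + (x, y)) - (f j \<circ> B') z)\<^sup>2)"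
      if sepd: "sqrt (sep_const q * h) \<le> sep_dir \<A> (f i) (f j)" and j: "j \<in> {0, 1}"
        and B: "B \<in> \<A>" "B' \<in> \<A>" for i j B B' a x y
    proof -
      \<comment> \<open>The separation quantity divides by the norm of the undeformed template, so
        the norm bound is taken at the identity deformation.\<close>
      have m: "0 < N j" "(N j)\<^sup>2 / (1024 * q\<^sup>2) \<le> (LINT z|lborel. (f j z)\<^sup>2)"
        using deformed[OF j adm[OF idA]] by (simp_all add: deformed_template_def)
      have "0 < (N j)\<^sup>2 / (1024 * q\<^sup>2)" using m(1) q by simp
      then have p: "0 < (LINT z|lborel. (f j z)\<^sup>2)" using m(2) by linarith
      have sh: "0 \<le> sep_const q * h" using pos h by simp
      have "sep_const q * h * ((N j)\<^sup>2 / (1024 * q\<^sup>2)) \<le> (sqrt (sep_const q * h))\<^sup>2 * (LINT z|lborel. (f j z)\<^sup>2)"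
        unfolding real_sqrt_pow2[OF sh] by (rule mult_left_mono[OF m(2) sh])
      also have "\<dots> \<le> (LINT z|lborel. (a * (f i \<circ> B) (z + (x, y)) - (f j \<circ> B') z)\<^sup>2)"
        unfolding comp_def by (rule sep_dir_lower[OF _ sepd B p]) (use sh in simp)
      finally show ?thesis .
    qed
    have "sqrt (sep_const q * h) \<le> sep_dir \<A> (f i) (f k) \<or> sqrt (sep_const q * h) \<le> sep_dir \<A> (f k) (f i)"
      using sep i k ik unfolding separation_def hd by (auto simp: le_max_iff_disj)
    then have "cosine d ?Y ?X s s' \<le> 1 - 2 * ?K * h"
    proof
      assume "sqrt (sep_const q * h) \<le> sep_dir \<A> (f i) (f k)"
      from lower[OF this k A' A] show ?thesis
        by (intro cosine_le_of_separated[OF deformed[OF i adm[OF A']] deformed[OF k adm[OF A]]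
              sample[OF i A'] image[OF k A] q h h1 hq _ \<kappa> K hK])
    next
      assume "sqrt (sep_const q * h) \<le> sep_dir \<A> (f k) (f i)"
      \<comment> \<open>Now the image is rescaled towards the filter; reversing the shift restores
        the cosine in question.\<close>
      from lower[OF this i A A'] have "cosine d ?X ?Y (- s) (- s') \<le> 1 - 2 * ?K * h"
        by (intro cosine_le_of_separated[OF deformed[OF k adm[OF A]] deformed[OF i adm[OF A']]
              image[OF k A] sample[OF i A'] q h h1 hq _ \<kappa> K hK])
      then show ?thesis
        by (simp add: cosine_commute[OF box_supported_zext box_supported_zext])
    qed
    then show "corr d (zext d (normalized d (block_sample \<alpha> d (f i \<circ> A')))) (zext d (normalized d (image_of d (f k) A 1))) s s' \<le> t"
      by (simp add: corr_normalized t)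
  qed
qed

section \<open>The data distribution and the resulting classifier\<close>

lemma data_model_AE:
  assumes "data_model \<A> q QA Q\<eta> P"
  shows "AE (k, A, \<eta>) in P. k \<in> {0, 1} \<and> A \<in> \<A> \<and> 0 < \<eta>"
proof -
  have sets: "sets P = sets (count_space UNIV \<Otimes>\<^sub>M (QA \<Otimes>\<^sub>M Q\<eta>))" and QA: "space QA = \<A>"
    and Q\<eta>: "sets Q\<eta> = sets (restrict_space borel {0<..})"
    and k: "distr P (count_space UNIV) fst = measure_pmf (map_pmf of_bool (bernoulli_pmf q))"
    using assms by (auto simp: data_model_def)
  have "space Q\<eta> = {0<..}"
    using sets_eq_imp_space_eq[OF Q\<eta>] by (simp add: space_restrict_space)
  then have space: "space P = UNIV \<times> (\<A> \<times> {0<..})"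
    using sets_eq_imp_space_eq[OF sets] QA by (simp add: space_pair_measure)
  have "fst \<in> measurable P (count_space UNIV)"
    by (subst measurable_cong_sets[OF sets refl]) (rule measurable_fst)
  moreover have "AE n in distr P (count_space UNIV) fst. n \<in> {0, 1 :: nat}"
    unfolding k by (auto simp: AE_measure_pmf_iff)
  ultimately have "AE \<omega> in P. fst \<omega> \<in> {0, 1 :: nat}"
    by (rule AE_distrD)
  \<comment> \<open>Only the label condition depends on the Bernoulli law; the conditions on
    deformation and brightness hold on the whole space of \<open>P\<close>.\<close>
  with AE_space show ?thesis
    by eventually_elim (auto simp: space)
qed

theorem theorem4p2:
  fixes C\<^sub>L C\<^sub>A :: real
  assumes "C\<^sub>L > 0"
  shows "\<exists>\<kappa>>0. \<forall>(d::nat) (f :: nat \<Rightarrow> plane \<Rightarrow> real) (R :: plane set)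
            (\<A> :: (plane \<Rightarrow> plane) set) (A_fin :: real \<Rightarrow> (plane \<Rightarrow> plane) set) (\<alpha>::real).
     d \<ge> 1 \<longrightarrow> templates f \<longrightarrow>
     assumption_1 C\<^sub>L R f \<longrightarrow> assumption_2i C\<^sub>A R f \<A> \<longrightarrow> assumption_3 d C\<^sub>A R f \<A> A_fin \<longrightarrow>
     0 < \<alpha> \<longrightarrow> \<alpha> \<le> 1 \<longrightarrow>
     separation \<A> (f 0) (f 1) \<ge> sqrt (\<kappa> / real d powr \<alpha>) \<longrightarrow>
     (\<forall>(q::real) (QA :: (plane \<Rightarrow> plane) measure) (Q\<eta> :: real measure)
        (P :: (nat \<times> (plane \<Rightarrow> plane) \<times> real) measure).
        data_model \<A> q QA Q\<eta> P \<longrightarrow>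
        (\<exists>p \<in> classifier_nets d \<alpha> (card (A_fin \<alpha>)).
           AE (k, A, \<eta>) in P. predicted_label d p (image_of d (f k) A \<eta>) = k))"
proof (intro exI conjI allI impI)
  let ?q = "C\<^sub>L * max 1 C\<^sub>A"
  show "0 < sep_const ?q"
    unfolding sep_const_def match_const_def using assms by (intro add_pos_pos mult_pos_pos) auto
  fix d :: nat and f :: "nat \<Rightarrow> plane \<Rightarrow> real" and R \<A> A_fin \<alpha> q QA Q\<eta>
    and P :: "(nat \<times> (plane \<Rightarrow> plane) \<times> real) measure"
  assume d: "d \<ge> 1" and templ: "templates f" and a1: "assumption_1 C\<^sub>L R f" and a2: "assumption_2i C\<^sub>A R f \<A>"
    and a3: "assumption_3 d C\<^sub>A R f \<A> A_fin" and \<alpha>: "0 < \<alpha>" "\<alpha> \<le> 1"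
    and sep: "separation \<A> (f 0) (f 1) \<ge> sqrt (sep_const ?q / real d powr \<alpha>)"
    and P: "data_model \<A> q QA Q\<eta> P"
  define t where "t = 1 - 2 * match_const ?q * real d powr (- \<alpha>)"
  define m where "m = card (A_fin \<alpha>)"
  define L where "L = 1 + 2 * nat \<lceil>log 2 (real m)\<rceil>"
  note separate = features_separate[OF assms d templ a1 a2 a3 \<alpha> sep, folded t_def]
  have "finite (A_fin \<alpha>)" using a3 \<alpha> by (simp add: assumption_3_def)
  then obtain e where e: "bij_betw e {1..m} (A_fin \<alpha>)"
    unfolding m_def using ex_bij_betw_nat_finite_1 by blast
  \<comment> \<open>The first \<open>m\<close> filters belong to class 0 and the next
    \<open>m\<close> to class 1, matching the two halves summed by the network.\<close>
  define W where "W s = normalized d (block_sample \<alpha> d (if s \<le> m then f 0 \<circ> e s else f 1 \<circ> e (s - m)))" for s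
  have "1 \<le> L" by (simp add: L_def)
  from threshold_network[OF separate(1) this, of m]
  obtain \<phi> where \<phi>: "\<phi> \<in> network_class softmax2 L ([2 * m] @ replicate L (4 * m) @ [2])"
    and \<phi>2: "\<And>x. \<phi> x 2 > 1 / 2 \<longleftrightarrow> (\<Sum>i=1..m. relu (x i - t)) < (\<Sum>i=m+1..2*m. relu (x i - t))"
    by blast
  define p where "p = \<phi> \<circ> (\<lambda>X s. cnn_feature d (W s) X)"
  have "(\<lambda>X s. cnn_feature d (W s) X) \<in> cnn_class d \<alpha> (2 * m)"
    unfolding cnn_class_def
    by (intro CollectI exI[of _ W] conjI refl ballI)
      (simp_all only: W_def block_structure_normalized block_structure_sample abs_normalized_le_1)
  with \<phi> have "p \<in> classifier_nets d \<alpha> (card (A_fin \<alpha>))"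
    unfolding classifier_nets_def Let_def m_def[symmetric] L_def[symmetric] p_def by blast
  moreover have "AE (k, A, \<eta>) in P. predicted_label d p (image_of d (f k) A \<eta>) = k"
    using data_model_AE[OF P]
  proof (rule AE_mp, intro AE_I2, clarify)
    fix k :: nat and A and \<eta> :: real
    assume k: "k \<in> {0, 1}" and A: "A \<in> \<A>" and \<eta>: "0 < \<eta>"
    define score where "score i = (\<Sum>s=1..m. relu (cnn_feature d (normalized d (block_sample \<alpha> d (f i \<circ> e s)))
      (normalized d (image_of d (f k) A 1)) - t))" for i
    have "(\<Sum>s=m+1..2*m. relu (cnn_feature d (W s) (normalized d (image_of d (f k) A 1)) - t)) = score 1"
      unfolding score_def
      by (rule sum.reindex_bij_witness[of _ "\<lambda>s. s + m" "\<lambda>s. s - m"]) (auto simp: W_def)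
    moreover have "(\<Sum>s=1..m. relu (cnn_feature d (W s) (normalized d (image_of d (f k) A 1)) - t)) = score 0"
      unfolding score_def by (intro sum.cong) (auto simp: W_def)
    ultimately have label: "predicted_label d p (image_of d (f k) A \<eta>) = of_bool (score 0 < score 1)"
      unfolding predicted_label_def normalized_image_of[OF \<eta>] p_def comp_def \<phi>2 by simp
    have zero: "score i = 0" if "i \<in> {0, 1}" "i \<noteq> k" for i
      unfolding score_def using separate(3)[OF k that A] bij_betwE[OF e]
      by (intro sum.neutral) (auto simp: relu_def)
    obtain A' where "A' \<in> A_fin \<alpha>"
      and A': "t < cnn_feature d (normalized d (block_sample \<alpha> d (f k \<circ> A'))) (normalized d (image_of d (f k) A 1))"
      using separate(2)[OF k A] by blast
    then obtain s where s: "s \<in> {1..m}" and "A' = e s"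
      using bij_betw_imp_surj_on[OF e] by blast
    with A' have hit: "t < cnn_feature d (normalized d (block_sample \<alpha> d (f k \<circ> e s))) (normalized d (image_of d (f k) A 1))"
      by simp
    \<comment> \<open>All summands are nonnegative, so the one filter above the threshold decides,
      whatever the others of its class do.\<close>
    have "0 < score k"
      unfolding score_def by (rule sum_pos2[OF _ s]) (use hit in \<open>auto simp: relu_def\<close>)
    with zero[of 0] zero[of 1] k show "predicted_label d p (image_of d (f k) A \<eta>) = k"
      unfolding label by auto
  qed
  ultimately show "\<exists>p \<in> classifier_nets d \<alpha> (card (A_fin \<alpha>)).
      AE (k, A, \<eta>) in P. predicted_label d p (image_of d (f k) A \<eta>) = k"
    by blast
qed

end
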